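(* Let $n\geqslant 4$ be even, and put \[ \beta_n:=\frac{C_n}{2^{n-1}}=\mathsf E_{\mathsf P_n}\Bigl|\sum_{j=1}^n \varepsilon_j\Bigr|, \qquad C_n:=\sum_{\ell=0}^{n/2-1}\binom n\ell (n-2\ell). \] Then for every real $\Lambda$ with \[ 2<\Lambda\leqslant 1+\beta_n \] there exists a closed codimension-$n$ subspace $Y$ of the real Banach space $C[0,1]$ such that \[ \lambda(Y,C[0,1])=\Lambda, \] and the infimum defining $\lambda(Y,C[0,1])$ is not attained.
   Context: $C[0,1]$ is the real Banach space of continuous real-valued functions on $[0,1]$ with the supremum norm. For a closed subspace $E$ of a Banach space $F$, the projection constant of $E$ in $F$ is $\lambda(E,F)=\inf\{\|P\| : P\colon F\to E \text{ bounded linear},\ P|_E=\mathrm{Id}_E\}$. $\mathsf P_n$ is the uniform probability measure on $\Omega_n=\{-1,1\}^n$, $\mathsf E_{\mathsf P_n}$ is the corresponding expectation, and $\varepsilon_j(\omega)=\omega_j$ for $\omega=(\omega_1,\dots,\omega_n)\in\Omega_n$ (independent Rademacher variables). *)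

theory Defs
  imports "HOL-Analysis.Analysis" "HOL-Probability.Probability"
begin

typedef unit_interval = "{0..1::real}"
  morphisms real_of_ui ui_of_real
  by (rule exI[of _ 0]) simp

instantiation unit_interval :: metric_space
begin

definition dist_unit_interval :: "unit_interval \<Rightarrow> unit_interval \<Rightarrow> real"
  where "dist_unit_interval x y = dist (real_of_ui x) (real_of_ui y)"

definition uniformity_unit_interval :: "(unit_interval \<times> unit_interval) filter"
  where "uniformity_unit_interval = (INF e\<in>{0 <..}. principal {(x, y). dist x y < e})"

definition open_unit_interval :: "unit_interval set \<Rightarrow> bool"
  where "open_unit_interval S = (\<forall>x\<in>S. \<forall>\<^sub>F (x', y) in uniformity. x' = x \<longrightarrow> y \<in> S)"

instance
proof
  fix x y z :: unit_interval
  show "dist x y = 0 \<longleftrightarrow> x = y"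
    by (simp add: dist_unit_interval_def real_of_ui_inject)
  show "dist x y \<le> dist x z + dist y z"
    unfolding dist_unit_interval_def by (rule dist_triangle2)
qed (rule open_unit_interval_def uniformity_unit_interval_def)+

end

lemma continuous_on_real_of_ui: "continuous_on UNIV real_of_ui"
  by (auto simp: continuous_on_iff dist_unit_interval_def)

lemma continuous_on_ui_of_real: "continuous_on {0..1} ui_of_real"
  by (auto simp: continuous_on_iff dist_unit_interval_def ui_of_real_inverse)

lemma ui_of_real_image: "ui_of_real ` {0..1} = UNIV"
  using type_definition.Abs_image[OF type_definition_unit_interval] by simp

lemma compact_UNIV_unit_interval: "compact (UNIV :: unit_interval set)"
  using compact_continuous_image[OF continuous_on_ui_of_real] ui_of_real_image by simp

text \<open>Since the unit interval is compact, boundedness is automatic, so the type below (whose norm is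
  the supremum norm) consists of all continuous real functions.\<close>

lemma bcontfun_unit_interval:
  "(f :: unit_interval \<Rightarrow> real) \<in> bcontfun \<longleftrightarrow> continuous_on UNIV f"
  using compact_imp_bounded[OF compact_continuous_image[OF _ compact_UNIV_unit_interval]]
  by (auto simp: bcontfun_def)

type_synonym C01 = "unit_interval \<Rightarrow>\<^sub>C real"

lemma C01_eq_continuous_on_interval:
  fixes g :: "real \<Rightarrow> real"
  assumes "continuous_on {0..1} g"
  shows "\<exists>!f :: C01. \<forall>x\<in>{0..1}. apply_bcontfun f (ui_of_real x) = g x"
proof (rule ex1I[of _ "Bcontfun (\<lambda>t. g (real_of_ui t))"])
  have "continuous_on UNIV (\<lambda>t. g (real_of_ui t))"
    by (rule continuous_on_compose2[OF assms continuous_on_real_of_ui])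
       (use real_of_ui in auto)
  then have *: "apply_bcontfun (Bcontfun (\<lambda>t. g (real_of_ui t))) = (\<lambda>t. g (real_of_ui t))"
    by (simp add: Bcontfun_inverse bcontfun_unit_interval)
  show "\<forall>x\<in>{0..1}. apply_bcontfun (Bcontfun (\<lambda>t. g (real_of_ui t))) (ui_of_real x) = g x"
    by (simp add: * ui_of_real_inverse)
  fix f :: C01
  assume f: "\<forall>x\<in>{0..1}. apply_bcontfun f (ui_of_real x) = g x"
  show "f = Bcontfun (\<lambda>t. g (real_of_ui t))"
  proof (rule bcontfun_eqI)
    fix t
    show "apply_bcontfun f t = apply_bcontfun (Bcontfun (\<lambda>t. g (real_of_ui t))) t"
      using f[rule_format, OF real_of_ui[of t]] by (simp add: * real_of_ui_inverse)
  qed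
qed

text \<open>The ambient space \<open>F\<close> is the whole type; a bounded operator \<open>F \<rightarrow> E\<close> is represented as a bounded
  operator on \<open>F\<close> with values in \<open>E\<close>, which has the same norm.\<close>

definition projections_onto :: "'a::real_normed_vector set \<Rightarrow> ('a \<Rightarrow>\<^sub>L 'a) set"
  where "projections_onto E =
    {P. (\<forall>x. blinfun_apply P x \<in> E) \<and> (\<forall>y\<in>E. blinfun_apply P y = y)}"

text \<open>The infimum is taken in the extended reals, so the value is \<open>\<infinity>\<close> if there is no bounded
  projection (the real infimum of the empty set would be unspecified).\<close>

definition projection_constant :: "'a::real_normed_vector set \<Rightarrow> ereal"
  where "projection_constant E = (INF P\<in>projections_onto E. ereal (norm P))"

definition projection_constant_attained :: "'a::real_normed_vector set \<Rightarrow> bool"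
  where "projection_constant_attained E \<longleftrightarrow>
    (\<exists>P\<in>projections_onto E. ereal (norm P) = projection_constant E)"

text \<open>The quotient by \<open>Y\<close> has dimension \<open>k\<close>: the cosets of the \<open>k\<close> elements of \<open>B\<close> form a basis of it.\<close>

definition has_codimension :: "'a::real_vector set \<Rightarrow> nat \<Rightarrow> bool"
  where "has_codimension Y k \<longleftrightarrow>
    (\<exists>B. finite B \<and> card B = k \<and> independent B \<and> span B \<inter> Y = {0} \<and>
         (\<forall>x. \<exists>b\<in>span B. x - b \<in> Y))"

definition sign_cube :: "nat \<Rightarrow> (nat \<Rightarrow> real) set"
  where "sign_cube n = PiE {1..n} (\<lambda>_. {-1, 1})"

definition sign_measure :: "nat \<Rightarrow> (nat \<Rightarrow> real) pmf"
  where "sign_measure n = pmf_of_set (sign_cube n)"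

definition rademacher :: "nat \<Rightarrow> (nat \<Rightarrow> real) \<Rightarrow> real"
  where "rademacher j \<omega> = \<omega> j"

definition C_const :: "nat \<Rightarrow> real"
  where "C_const n = (\<Sum>l<n div 2. real (n choose l) * (real n - 2 * real l))"

definition beta_const :: "nat \<Rightarrow> real"
  where "beta_const n = C_const n / 2 ^ (n - 1)"

end

theory Submission
  imports Defs
begin

text \<open>The interval is cut into \<open>K = 2 ^ n + n\<close> equal cells.  Writing \<open>L\<^sub>k\<close> for the mean value over the
  \<open>k\<close>-th cell and choosing vectors \<open>v\<^sub>k\<close> in \<open>n\<close>-space, let \<open>Y\<close> be the common kernel of the functionals
  \<open>\<mu>\<^sub>j = (\<Sum>k. v\<^sub>k(j) L\<^sub>k)\<close>.  Every projection onto \<open>Y\<close> has the form \<open>P h = h - (\<Sum>j. \<mu>\<^sub>j(h) f\<^sub>j)\<close> with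
  continuous \<open>f\<^sub>j\<close> biorthogonal to the \<open>\<mu>\<^sub>j\<close>.  The \<open>\<mu>\<^sub>j\<close> have no atoms, so a test
  function of norm 1 may take the value 1 at a given point while its cell means are arbitrarily close to
  prescribed numbers in \<open>[-1, 1]\<close>; hence \<open>\<parallel>P\<parallel> \<ge> 1 + N(f(t))\<close> for every point \<open>t\<close>,
  where \<open>N(x) = (\<Sum>k. \<bar>\<langle>x, v\<^sub>k\<rangle>\<bar>)\<close> (lemma \<open>norm_projection_ge\<close>).

  Biorthogonality forces the trace identity \<open>(\<Sum>k. L\<^sub>k \<langle>f, v\<^sub>k\<rangle>) = n\<close>.  If \<open>\<langle>x, v\<^sub>k\<rangle> \<le> c\<^sub>k N(x)\<close> for all
  \<open>x\<close> and \<open>(\<Sum>k. c\<^sub>k) r = n\<close>, then \<open>sup N(f(t)) \<ge> r\<close>, and equality requires \<open>\<langle>f(t), v\<^sub>k\<rangle> = c\<^sub>k r\<close> on the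
  whole \<open>k\<close>-th cell (lemma \<open>biorthogonal_sup_ge\<close>).  Conversely, vectors \<open>x\<^sub>k\<close> with \<open>N(x\<^sub>k) \<le> r\<close> that are
  dual to the \<open>v\<^sub>k\<close> describe an optimal \<open>f\<close> that is constant on each cell; rounding off its jumps costs
  arbitrarily little, so the projection constant is exactly \<open>1 + r\<close> (lemma
  \<open>step_kernel_projection_constant\<close>).

  On the first \<open>2 ^ n\<close> cells the \<open>v\<^sub>k\<close> run through the sign vectors with total weight \<open>1 - s\<close>, on the last
  \<open>n\<close> cells through the unit vectors with weight \<open>s\<close> each.  Then \<open>N\<close> is the mixture of
  \<open>x \<mapsto> E \<bar>\<langle>x, \<epsilon>\<rangle>\<bar>\<close> and the \<open>\<ell>\<^sub>1\<close>-norm, and the symmetries of the cube give the optimal constants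
  explicitly: with \<open>\<beta> = E \<bar>\<Sum>j. \<epsilon>\<^sub>j\<bar>\<close> the value of \<open>r\<close> runs continuously from \<open>\<beta>\<close> at \<open>s = 0\<close> to \<open>1\<close> at
  \<open>s = 1\<close>, so every \<open>r\<close> in \<open>(1, \<beta>]\<close> occurs for some \<open>s < 1\<close>.

  Evenness of \<open>n\<close> rules out an optimal projection.  On a sign cell with vector \<open>\<omega>\<close> optimality would
  force \<open>f(t)\<close> to be a maximizer of \<open>\<langle>x, \<omega>\<rangle>\<close> on a ball of \<open>N\<close>; since for
  even \<open>n\<close> there are sign vectors \<open>\<epsilon>\<close> orthogonal to \<open>\<omega>\<close>, the norm \<open>E \<bar>\<langle>x, \<epsilon>\<rangle>\<bar>\<close> has a kink at \<open>\<omega>\<close> and only multiples of \<open>\<omega>\<close>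
  are maximizers (lemma \<open>rademacher_norm_equality\<close>).  At the common endpoint of two adjacent sign cells
  \<open>f\<close> would therefore have two different values.\<close>

section \<open>Means over equal cells of the unit interval\<close>

lemma apply_Bcontfun_C01:
  fixes f :: "unit_interval \<Rightarrow> real"
  shows "continuous_on UNIV f \<Longrightarrow> apply_bcontfun (Bcontfun f) = f"
  by (simp add: Bcontfun_inverse bcontfun_unit_interval)

lemma continuous_on_C01: "continuous_on S (apply_bcontfun (f :: C01))"
  using apply_bcontfun[of f] unfolding bcontfun_def
  by (auto intro: continuous_on_subset)

lemma apply_bcontfun_sum:
  "apply_bcontfun (sum f A) t = (\<Sum>i\<in>A. apply_bcontfun (f i) t)"
  by (induction A rule: infinite_finite_induct) (auto simp: plus_bcontfun.rep_eq)

lemma norm_C01_le: "(\<And>t. \<bar>apply_bcontfun f t\<bar> \<le> b) \<Longrightarrow> norm (f :: C01) \<le> b"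
  by (rule norm_bound) auto

definition cell :: "nat \<Rightarrow> nat \<Rightarrow> real set"
  where "cell K k = {real k / real K..real (Suc k) / real K}"

definition cell_mean :: "nat \<Rightarrow> nat \<Rightarrow> C01 \<Rightarrow> real"
  where "cell_mean K k h = real K * integral (cell K k)
    (\<lambda>u. apply_bcontfun h (ui_of_real u))"

lemma cell_subset: "k < K \<Longrightarrow> cell K k \<subseteq> {0..1}"
proof
  fix u assume "k < K" and u: "u \<in> cell K k"
  then have "real (Suc k) / real K \<le> 1" by simp
  moreover have "0 \<le> real k / real K" by simp
  ultimately show "u \<in> {0..1}" using u unfolding cell_def atLeastAtMost_iff by linarith
qed

lemma cell_integrable:
  assumes "k < K"
  shows "(\<lambda>u. apply_bcontfun (h::C01) (ui_of_real u)) integrable_on cell K k"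
    and "continuous_on (cell K k) (\<lambda>u. apply_bcontfun (h::C01) (ui_of_real u))"
proof -
  have "continuous_on {0..1} (\<lambda>u. apply_bcontfun h (ui_of_real u))"
    by (rule continuous_on_compose2[OF continuous_on_C01 continuous_on_ui_of_real]) auto
  then show "continuous_on (cell K k) (\<lambda>u. apply_bcontfun h (ui_of_real u))"
    by (rule continuous_on_subset[OF _ cell_subset[OF assms]])
  then show "(\<lambda>u. apply_bcontfun h (ui_of_real u)) integrable_on cell K k"
    unfolding cell_def by (rule integrable_continuous_real)
qed

lemma integral_const_cell: "k < K \<Longrightarrow> real K * integral (cell K k) (\<lambda>u. c) = c"
  using divide_right_mono[of "real k" "1 + real k" "real K"] by (simp add: cell_def field_simps)

lemma cell_mean_mono:
  assumes "k < K"
    and "\<And>u. u \<in> cell K k \<Longrightarrow>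
      apply_bcontfun g (ui_of_real u) \<le> apply_bcontfun h (ui_of_real u)"
  shows "cell_mean K k g \<le> cell_mean K k h"
  unfolding cell_mean_def
  by (intro mult_left_mono integral_le cell_integrable assms) auto

lemma cell_mean_const:
  assumes "k < K"
    and "\<And>u. u \<in> cell K k \<Longrightarrow> apply_bcontfun h (ui_of_real u) = c"
  shows "cell_mean K k h = c"
proof -
  have "integral (cell K k) (\<lambda>u. apply_bcontfun h (ui_of_real u)) =
      integral (cell K k) (\<lambda>u. c)"
    by (rule integral_cong) (use assms in auto)
  moreover have "real K * integral (cell K k) (\<lambda>u. c) = c"
    using assms(1) by (rule integral_const_cell)
  ultimately show ?thesis
    by (simp add: cell_mean_def)
qed

lemma cell_mean_add: "k < K \<Longrightarrow> cell_mean K k (g + h) = cell_mean K k g + cell_mean K k h"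
  by (simp add: cell_mean_def plus_bcontfun.rep_eq Henstock_Kurzweil_Integration.integral_add
      cell_integrable distrib_left)

lemma cell_mean_scaleR: "cell_mean K k (c *\<^sub>R h) = c * cell_mean K k h"
  by (simp add: cell_mean_def)

lemma cell_mean_bound:
  assumes "k < K" shows "\<bar>cell_mean K k h\<bar> \<le> norm h"
proof -
  have c: "apply_bcontfun (Bcontfun (\<lambda>t::unit_interval. c)) = (\<lambda>t. c)" for c :: real
    by (rule apply_Bcontfun_C01) simp
  have b: "\<bar>apply_bcontfun h t\<bar> \<le> norm h" for t
    using norm_bounded[of h t] by simp
  have "cell_mean K k h \<le> cell_mean K k (Bcontfun (\<lambda>t. norm h))"
    by (rule cell_mean_mono[OF assms]) (use b c in \<open>force simp: abs_le_iff\<close>)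
  moreover have "cell_mean K k (Bcontfun (\<lambda>t. - norm h)) \<le> cell_mean K k h"
    by (rule cell_mean_mono[OF assms], unfold c) (use b in \<open>smt (verit)\<close>)
  ultimately show ?thesis
    using cell_mean_const[OF assms, of "Bcontfun (\<lambda>t. norm h)" "norm h"]
      cell_mean_const[OF assms, of "Bcontfun (\<lambda>t. - norm h)" "- norm h"] by (simp add: c)
qed

lemma bounded_linear_cell_mean: "k < K \<Longrightarrow> bounded_linear (cell_mean K k)"
  by (rule bounded_linear_intro[where K = 1])
     (auto simp: cell_mean_add cell_mean_scaleR cell_mean_bound)

text \<open>This is how an equality between cell means becomes a pointwise equality, also at the endpoints of
  the cell; the endpoints are where the optimal step function jumps.\<close>
lemma cell_mean_eq_0D:
  assumes "k < K" "cell_mean K k h = 0" "\<And>t. apply_bcontfun h t \<ge> 0"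
    and "u \<in> cell K k"
  shows "apply_bcontfun h (ui_of_real u) = 0"
proof -
  have "real k / real K < real (Suc k) / real K"
    using assms(1) by (simp add: divide_strict_right_mono)
  then show ?thesis
    using integral_eq_0_iff[OF cell_integrable(2)[OF assms(1), of h, unfolded cell_def]] assms
    by (auto simp: cell_mean_def cell_def)
qed

text \<open>Dominated convergence.  The finite exceptional set is harmless because the means have no atoms: it
  will consist of the endpoints of a cell or of the peak of a narrow spike.\<close>
lemma cell_mean_tendsto:
  fixes h :: "nat \<Rightarrow> C01"
  assumes k: "k < K" and bound: "\<And>m t. \<bar>apply_bcontfun (h m) t\<bar> \<le> 1"
    and fin: "finite F"
    and lim: "\<And>u. u \<in> cell K k - F \<Longrightarrow>
      (\<lambda>m. apply_bcontfun (h m) (ui_of_real u)) \<longlonglongrightarrow> c"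
  shows "(\<lambda>m. cell_mean K k (h m)) \<longlonglongrightarrow> c"
proof -
  let ?S = "cell K k"
  let ?f = "\<lambda>m u. if u \<in> F then c else apply_bcontfun (h m) (ui_of_real u)"
  have i: "integral ?S (?f m) = integral ?S (\<lambda>u. apply_bcontfun (h m) (ui_of_real u))" for m
    by (rule integral_spike[OF negligible_finite[OF fin]]) auto
  have int: "?f m integrable_on ?S" for m
    by (rule integrable_spike[OF cell_integrable(1)[OF k, of "h m"] negligible_finite[OF fin]]) auto
  have "(\<lambda>m. integral ?S (?f m)) \<longlonglongrightarrow> integral ?S (\<lambda>u. c)"
  proof (rule dominated_convergence(2)[OF int])
    show "(\<lambda>u. max 1 \<bar>c\<bar>) integrable_on ?S" unfolding cell_def by (rule integrable_const_ivl)
    show "norm (?f m u) \<le> max 1 \<bar>c\<bar>" for m u using bound[of m "ui_of_real u"] by auto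
    show "(\<lambda>m. ?f m u) \<longlonglongrightarrow> c" if "u \<in> ?S" for u using lim[of u] that by (cases "u \<in> F") auto
  qed
  from tendsto_mult_left[OF this, of "real K"]
  show ?thesis
    unfolding cell_mean_def i integral_const_cell[OF k] .
qed

text \<open>Trapezoids with ever steeper flanks have means tending to 1, so a steep one can be rescaled to
  mean exactly 1 while its height grows only to \<open>1 + e\<close>.\<close>
lemma cell_bump:
  assumes k: "k < K" and e: "e > 0"
  obtains \<phi> :: C01 where "\<And>t. 0 \<le> apply_bcontfun \<phi> t" "\<And>t. apply_bcontfun \<phi> t \<le> 1 + e"
    "\<And>t. apply_bcontfun \<phi> t \<noteq> 0 \<Longrightarrow> real_of_ui t \<in> {real k / real K<..<real (Suc k) / real K}"
    "cell_mean K k \<phi> = 1"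
proof -
  define a b where "a = real k / real K" and "b = real (Suc k) / real K"
  have ab: "a < b" unfolding a_def b_def using k by (simp add: divide_strict_right_mono)
  define q where "q m t = max 0 (min 1 (real m * min (real_of_ui t - a) (b - real_of_ui t)))" for m t
  define h where "h m = Bcontfun (q m)" for m
  have h: "apply_bcontfun (h m) = q m" for m
    unfolding h_def q_def
    by (intro apply_Bcontfun_C01 continuous_intros continuous_on_real_of_ui)
  have lim: "(\<lambda>m. cell_mean K k (h m)) \<longlonglongrightarrow> 1"
  proof (rule cell_mean_tendsto[OF k, where F = "{a, b}"])
    show "\<bar>apply_bcontfun (h m) t\<bar> \<le> 1" for m t by (simp add: h q_def)
    fix u assume u: "u \<in> cell K k - {a, b}"
    define d where "d = min (u - a) (b - u)"
    have d: "d > 0" using u by (auto simp: cell_def d_def a_def b_def)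
    have "u \<in> {0..1}" using u cell_subset[OF k] by auto
    then have r: "real_of_ui (ui_of_real u) = u" by (simp add: ui_of_real_inverse)
    obtain m0 where m0: "1 < real m0 * d" using reals_Archimedean3[OF d, rule_format, of 1] by auto
    have scale: "1 < real m * d" if "m \<ge> m0" for m
      using m0 mult_right_mono[of "real m0" "real m" d] that d by linarith
    then have "apply_bcontfun (h m) (ui_of_real u) = 1" if "m \<ge> m0" for m
      using scale[OF that] unfolding h q_def r d_def[symmetric] by simp
    then show "(\<lambda>m. apply_bcontfun (h m) (ui_of_real u)) \<longlonglongrightarrow> 1"
      by (intro tendsto_eventually) (auto simp: eventually_sequentially)
  qed simp
  have "1 / (1 + e) < 1" using e by simp
  from order_tendstoD(1)[OF lim this] obtain m where m: "1 / (1 + e) < cell_mean K k (h m)"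
    by (auto simp: eventually_sequentially)
  define c where "c = 1 / cell_mean K k (h m)"
  have c: "0 < c" "c \<le> 1 + e" "c * cell_mean K k (h m) = 1"
  proof -
    have "0 < 1 / (1 + e)" using e by simp
    with m have p: "0 < cell_mean K k (h m)" by linarith
    then show "0 < c" "c * cell_mean K k (h m) = 1" by (auto simp: c_def)
    show "c \<le> 1 + e" using m p e by (simp add: c_def field_simps)
  qed
  show ?thesis
  proof (rule that[of "c *\<^sub>R h m"])
    show "0 \<le> apply_bcontfun (c *\<^sub>R h m) t" for t using c by (simp add: h q_def)
    have "c * q m t \<le> c * 1" for t by (rule mult_left_mono) (use c in \<open>auto simp: q_def\<close>)
    then show "apply_bcontfun (c *\<^sub>R h m) t \<le> 1 + e" for t
      using c(2) order_trans by (fastforce simp: h)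
    show "real_of_ui t \<in> {real k / real K<..<real (Suc k) / real K}"
      if "apply_bcontfun (c *\<^sub>R h m) t \<noteq> 0" for t
    proof -
      have "0 < real m * min (real_of_ui t - a) (b - real_of_ui t)"
        using that by (auto simp: h q_def max_def split: if_splits)
      then show ?thesis by (auto simp: zero_less_mult_iff a_def b_def)
    qed
    show "cell_mean K k (c *\<^sub>R h m) = 1" using c by (simp add: cell_mean_scaleR)
  qed
qed

lemma cells_disjoint:
  assumes "u \<in> {real k / real K<..<real (Suc k) / real K}"
    and "u \<in> cell K i" and "0 < K"
  shows "i = k"
proof -
  have "real k < u * K" "u * K < real (Suc k)" "real i \<le> u * K" "u * K \<le> real (Suc i)"
    using assms by (auto simp: cell_def field_simps)
  then have "real k < real (Suc i)" "real i < real (Suc k)" by linarith+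
  then show ?thesis by linarith
qed

text \<open>Bumps for all cells at once: they have disjoint supports and are biorthogonal to the cell means,
  so they are continuous substitutes for the indicator functions of the cells.\<close>
lemma cell_bumps:
  assumes "0 < K" "e > 0"
  obtains \<phi> :: "nat \<Rightarrow> C01" where
    "\<And>k t. k < K \<Longrightarrow> 0 \<le> apply_bcontfun (\<phi> k) t" "\<And>k t. k < K \<Longrightarrow> apply_bcontfun (\<phi> k) t \<le> 1 + e"
    "\<And>i k t. i < K \<Longrightarrow> k < K \<Longrightarrow> apply_bcontfun (\<phi> k) t \<noteq> 0 \<Longrightarrow> apply_bcontfun (\<phi> i) t \<noteq> 0 \<Longrightarrow> i = k"
    "\<And>i k. i < K \<Longrightarrow> k < K \<Longrightarrow> cell_mean K i (\<phi> k) = (if i = k then 1 else 0)"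
proof -
  have "\<forall>k. \<exists>\<phi>::C01. k < K \<longrightarrow> (\<forall>t. 0 \<le> apply_bcontfun \<phi> t) \<and> (\<forall>t. apply_bcontfun \<phi> t \<le> 1 + e) \<and>
     (\<forall>t. apply_bcontfun \<phi> t \<noteq> 0 \<longrightarrow> real_of_ui t \<in> {real k / real K<..<real (Suc k) / real K}) \<and>
     cell_mean K k \<phi> = 1"
    using cell_bump[OF _ assms(2)] by metis
  then obtain \<phi> where \<phi>: "\<And>k. k < K \<Longrightarrow> (\<forall>t. 0 \<le> apply_bcontfun (\<phi> k) t) \<and> (\<forall>t. apply_bcontfun (\<phi> k) t \<le> 1 + e) \<and>
     (\<forall>t. apply_bcontfun (\<phi> k) t \<noteq> 0 \<longrightarrow> real_of_ui t \<in> {real k / real K<..<real (Suc k) / real K}) \<and>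
     cell_mean K k (\<phi> k :: C01) = 1"
    by metis
  show ?thesis
  proof (rule that[of \<phi>])
    show "i = k" if "i < K" "k < K" "apply_bcontfun (\<phi> k) t \<noteq> 0" "apply_bcontfun (\<phi> i) t \<noteq> 0" for i k t
    proof (rule cells_disjoint[OF _ _ assms(1)])
      show "real_of_ui t \<in> {real k / real K<..<real (Suc k) / real K}" using \<phi> that by blast
      have "real_of_ui t \<in> {real i / real K<..<real (Suc i) / real K}" using \<phi> that by blast
      then show "real_of_ui t \<in> cell K i" by (auto simp: cell_def)
    qed
    show "cell_mean K i (\<phi> k) = (if i = k then 1 else 0)" if ik: "i < K" "k < K" for i k
    proof (cases "i = k")
      case False
      have "cell_mean K i (\<phi> k) = 0"
      proof (rule cell_mean_const[OF ik(1)], rule ccontr)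
        fix u assume u: "u \<in> cell K i"
          "apply_bcontfun (\<phi> k) (ui_of_real u) \<noteq> 0"
        then have "real_of_ui (ui_of_real u) = u"
          using cell_subset[OF ik(1)] by (intro ui_of_real_inverse) auto
        with u \<phi>[OF ik(2)] have "u \<in> {real k / real K<..<real (Suc k) / real K}" by metis
        from cells_disjoint[OF this u(1) assms(1)] False show False by simp
      qed
      with False show ?thesis by simp
    qed (use \<phi> ik in simp)
  qed (use \<phi> in auto)
qed

text \<open>The value at a single point is independent of the cell means.  A combination \<open>g\<close> of bumps has
  almost the required means; mixing it with the constant 1 by means of a spike at \<open>t\<close> changes the value at
  \<open>t\<close> to 1, keeps the norm at most 1, and alters the means by an amount that vanishes as the spike narrows.\<close>
lemma peaked_function_with_cell_means:
  assumes K: "0 < K" and \<sigma>: "\<And>k. \<bar>\<sigma> k\<bar> \<le> 1" and e: "e > 0"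
  obtains h :: C01 where "norm h \<le> 1" "apply_bcontfun h t = 1"
    "\<And>k. k < K \<Longrightarrow> \<bar>cell_mean K k h - \<sigma> k\<bar> \<le> e"
proof -
  obtain \<phi> :: "nat \<Rightarrow> C01" where \<phi>:
    "\<And>k t. k < K \<Longrightarrow> 0 \<le> apply_bcontfun (\<phi> k) t" "\<And>k t. k < K \<Longrightarrow> apply_bcontfun (\<phi> k) t \<le> 1 + e/2"
    "\<And>i k t. i < K \<Longrightarrow> k < K \<Longrightarrow> apply_bcontfun (\<phi> k) t \<noteq> 0 \<Longrightarrow> apply_bcontfun (\<phi> i) t \<noteq> 0 \<Longrightarrow> i = k"
    "\<And>i k. i < K \<Longrightarrow> k < K \<Longrightarrow> cell_mean K i (\<phi> k) = (if i = k then 1 else 0)"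
    using cell_bumps[OF K, of "e/2"] e by auto
  define g where "g = (\<Sum>k<K. (\<sigma> k / (1 + e/2)) *\<^sub>R \<phi> k)"
  have mg: "cell_mean K i g = \<sigma> i / (1 + e/2)" if "i < K" for i
  proof -
    have "cell_mean K i g = (\<Sum>k<K. (\<sigma> k / (1 + e/2)) * cell_mean K i (\<phi> k))"
      unfolding g_def
      by (simp add: linear_sum[OF bounded_linear.linear[OF bounded_linear_cell_mean[OF that]]] cell_mean_scaleR)
    also have "\<dots> = (\<Sum>k<K. if k = i then \<sigma> i / (1 + e/2) else 0)"
      by (rule sum.cong) (use \<phi>(4)[OF that] in auto)
    finally show ?thesis using that by simp
  qed
  have bg: "\<bar>apply_bcontfun g x\<bar> \<le> 1" for x
  proof (cases "\<exists>k<K. apply_bcontfun (\<phi> k) x \<noteq> 0")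
    case True
    then obtain k where k: "k < K" "apply_bcontfun (\<phi> k) x \<noteq> 0" by auto
    have "apply_bcontfun g x = (\<Sum>i<K. if i = k then \<sigma> k / (1 + e/2) * apply_bcontfun (\<phi> k) x else 0)"
      unfolding g_def apply_bcontfun_sum
      by (rule sum.cong) (use \<phi>(3)[OF _ k] in auto)
    then have "\<bar>apply_bcontfun g x\<bar> = \<bar>\<sigma> k\<bar> * (apply_bcontfun (\<phi> k) x / (1 + e/2))"
      using k \<phi>(1)[OF k(1)] e by (simp add: abs_mult)
    also have "\<dots> \<le> 1 * 1"
      using \<phi>(1,2)[OF k(1), of x] e \<sigma>[of k] by (intro mult_mono) auto
    finally show ?thesis by simp
  next
    case False
    then have "apply_bcontfun g x = 0" by (simp add: g_def apply_bcontfun_sum)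
    then show ?thesis by simp
  qed
  define q where "q m x = max 0 (1 - real m * dist x t)" for m x
  have q: "0 \<le> q m x" "q m x \<le> 1" for m x by (auto simp: q_def)
  define h where "h m = Bcontfun (\<lambda>x. q m x + (1 - q m x) * apply_bcontfun g x)" for m
  have h: "apply_bcontfun (h m) = (\<lambda>x. q m x + (1 - q m x) * apply_bcontfun g x)" for m
    unfolding h_def q_def
    by (intro apply_Bcontfun_C01 continuous_intros continuous_on_C01)
  have conv: "\<bar>apply_bcontfun (h m) x\<bar> \<le> 1" for m x
  proof -
    have "\<bar>apply_bcontfun (h m) x\<bar> \<le> q m x + (1 - q m x) * \<bar>apply_bcontfun g x\<bar>"
      unfolding h using q[of m x] abs_triangle_ineq[of "q m x" "(1 - q m x) * apply_bcontfun g x"]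
      by (simp add: abs_mult)
    also have "\<dots> \<le> q m x + (1 - q m x) * 1"
      using q[of m x] bg[of x] by (intro add_left_mono mult_left_mono) auto
    finally show ?thesis by simp
  qed
  have lim: "(\<lambda>m. cell_mean K k (h m)) \<longlonglongrightarrow> cell_mean K k g" if k: "k < K" for k
  proof -
    \<comment> \<open>The factor \<open>1/2\<close> brings the difference \<open>h m - g\<close> under the bound 1 of the convergence lemma.\<close>
    have "(\<lambda>m. cell_mean K k ((1/2) *\<^sub>R (h m - g))) \<longlonglongrightarrow> 0"
    proof (rule cell_mean_tendsto[OF k, where F = "{real_of_ui t}"])
      show "\<bar>apply_bcontfun ((1/2) *\<^sub>R (h m - g)) x\<bar> \<le> 1" for m x
        using conv[of m x] bg[of x] by (simp add: minus_bcontfun.rep_eq abs_le_iff)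
      fix u assume u: "u \<in> cell K k - {real_of_ui t}"
      have "u \<in> {0..1}" using u cell_subset[OF k] by auto
      then have r: "real_of_ui (ui_of_real u) = u" by (simp add: ui_of_real_inverse)
      define d where "d = dist (ui_of_real u) t"
      have d: "d > 0" using u r by (auto simp: d_def dist_unit_interval_def)
      obtain m0 where m0: "1 < real m0 * d" using reals_Archimedean3[OF d, rule_format, of 1] by auto
    have scale: "1 < real m * d" if "m \<ge> m0" for m
      using m0 mult_right_mono[of "real m0" "real m" d] that d by linarith
      then have "apply_bcontfun ((1/2) *\<^sub>R (h m - g)) (ui_of_real u) = 0" if "m \<ge> m0" for m
      using scale[OF that] by (simp add: h q_def minus_bcontfun.rep_eq d_def[symmetric])
      then show "(\<lambda>m. apply_bcontfun ((1/2) *\<^sub>R (h m - g)) (ui_of_real u)) \<longlonglongrightarrow> 0"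
        by (intro tendsto_eventually) (auto simp: eventually_sequentially)
    qed simp
    moreover have "cell_mean K k ((1/2) *\<^sub>R (h m - g)) = (cell_mean K k (h m) - cell_mean K k g) / 2" for m
      by (simp add: cell_mean_scaleR linear_diff[OF bounded_linear.linear[OF bounded_linear_cell_mean[OF k]]])
    ultimately have "(\<lambda>m. 2 * ((cell_mean K k (h m) - cell_mean K k g) / 2) + cell_mean K k g)
        \<longlonglongrightarrow> 2 * 0 + cell_mean K k g"
      by (intro tendsto_intros) simp
    then show ?thesis by (simp add: add_divide_distrib diff_divide_distrib)
  qed
  have "\<forall>\<^sub>F m in sequentially. \<forall>k\<in>{..<K}. \<bar>cell_mean K k (h m) - cell_mean K k g\<bar> < e/2"
    using tendstoD[OF lim, of _ "e/2"] e
    by (intro eventually_ball_finite ballI) (simp_all add: dist_real_def)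
  then obtain m where m: "\<And>k. k < K \<Longrightarrow> \<bar>cell_mean K k (h m) - cell_mean K k g\<bar> < e/2"
    by (auto simp: eventually_sequentially)
  show ?thesis
  proof (rule that[of "h m"])
    show "norm (h m) \<le> 1" by (rule norm_C01_le) (rule conv)
    show "apply_bcontfun (h m) t = 1" by (simp add: h q_def)
    fix k assume k: "k < K"
    have "\<bar>\<sigma> k - \<sigma> k / (1 + e/2)\<bar> = \<bar>\<sigma> k\<bar> * (e/2 / (1 + e/2))"
    proof -
      have "\<sigma> k - \<sigma> k / (1 + e/2) = \<sigma> k * (e/2 / (1 + e/2))" using e by (simp add: field_simps)
      then show ?thesis using e by (simp add: abs_mult)
    qed
    also have "\<dots> \<le> 1 * (e/2)"
      using e \<sigma>[of k] by (intro mult_mono) (auto simp: field_simps)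
    finally show "\<bar>cell_mean K k (h m) - \<sigma> k\<bar> \<le> e"
      using m[OF k] mg[OF k] by linarith
  qed
qed

section \<open>Projections onto kernels of step functionals\<close>

definition pairing :: "nat \<Rightarrow> (nat \<Rightarrow> real) \<Rightarrow> (nat \<Rightarrow> real) \<Rightarrow> real"
  where "pairing n x y = (\<Sum>j=1..n. x j * y j)"

definition step_functional :: "nat \<Rightarrow> (nat \<Rightarrow> nat \<Rightarrow> real) \<Rightarrow> nat \<Rightarrow> C01 \<Rightarrow> real"
  where "step_functional K v j h = (\<Sum>k<K. v k j * cell_mean K k h)"

text \<open>Up to the identification of \<open>x\<close> with \<open>\<Sum>j. x\<^sub>j \<mu>\<^sub>j\<close>, where \<open>\<mu>\<^sub>j\<close> is the \<open>j\<close>-th step functional, this is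
  the norm of the dual space of continuous functions: distinct cell means are mutually singular measures of
  total mass 1.\<close>
definition step_norm :: "nat \<Rightarrow> nat \<Rightarrow> (nat \<Rightarrow> nat \<Rightarrow> real) \<Rightarrow> (nat \<Rightarrow> real) \<Rightarrow> real"
  where "step_norm n K v x = (\<Sum>k<K. \<bar>pairing n x (v k)\<bar>)"

definition step_kernel :: "nat \<Rightarrow> nat \<Rightarrow> (nat \<Rightarrow> nat \<Rightarrow> real) \<Rightarrow> C01 set"
  where "step_kernel n K v = {h. \<forall>j\<in>{1..n}. step_functional K v j h = 0}"

lemma bounded_linear_step_functional: "bounded_linear (step_functional K v j)"
proof -
  have "bounded_linear (\<lambda>h. \<Sum>k<K. v k j * cell_mean K k h)"
    by (intro bounded_linear_sum bounded_linear_const_mult bounded_linear_cell_mean) auto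
  then show ?thesis
    by (simp add: step_functional_def[abs_def])
qed

lemmas linear_step_functional = bounded_linear.linear[OF bounded_linear_step_functional]

lemma step_functional_simps:
  "step_functional K v j (g + h) = step_functional K v j g + step_functional K v j h"
  "step_functional K v j (g - h) = step_functional K v j g - step_functional K v j h"
  "step_functional K v j (c *\<^sub>R h) = c * step_functional K v j h"
  "step_functional K v j (\<Sum>i\<in>A. F i) = (\<Sum>i\<in>A. step_functional K v j (F i))"
  "step_functional K v j 0 = 0"
  using linear_step_functional[of K v j]
  by (simp_all add: linear_add linear_diff linear_scale linear_sum linear_0)

lemma sum_step_functional:
  "(\<Sum>j=1..n. c j * step_functional K v j h) = (\<Sum>k<K. pairing n c (v k) * cell_mean K k h)"
proof -
  have "(\<Sum>j=1..n. c j * step_functional K v j h) = (\<Sum>j=1..n. \<Sum>k<K. c j * v k j * cell_mean K k h)"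
    by (simp add: step_functional_def sum_distrib_left mult.assoc)
  also have "\<dots> = (\<Sum>k<K. \<Sum>j=1..n. c j * v k j * cell_mean K k h)"
    by (rule sum.swap)
  finally show ?thesis
    by (simp add: pairing_def sum_distrib_right)
qed

definition biorthogonal :: "nat \<Rightarrow> nat \<Rightarrow> (nat \<Rightarrow> nat \<Rightarrow> real) \<Rightarrow> (nat \<Rightarrow> C01) \<Rightarrow> bool"
  where "biorthogonal n K v f \<longleftrightarrow>
    (\<forall>i\<in>{1..n}. \<forall>j\<in>{1..n}. step_functional K v i (f j) = (if i = j then 1 else 0))"

lemma step_functional_biorthogonal_sum:
  assumes "biorthogonal n K v f" "i \<in> {1..n}"
  shows "step_functional K v i (\<Sum>j=1..n. c j *\<^sub>R f j) = c i"
proof -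
  have "step_functional K v i (\<Sum>j=1..n. c j *\<^sub>R f j) = (\<Sum>j=1..n. if j = i then c i else 0)"
    unfolding step_functional_simps
    by (rule sum.cong) (use assms in \<open>auto simp: biorthogonal_def\<close>)
  then show ?thesis using assms(2) by simp
qed

lemma subspace_step_kernel: "subspace (step_kernel n K v)"
  by (auto simp: subspace_def step_kernel_def step_functional_simps)

lemma closed_step_kernel: "closed (step_kernel n K v)"
proof -
  have "step_kernel n K v = (\<Inter>j\<in>{1..n}. {h. step_functional K v j h = 0})"
    by (auto simp: step_kernel_def)
  moreover have "closed {h. step_functional K v j h = 0}" for j
    by (intro closed_Collect_eq linear_continuous_on bounded_linear_step_functional continuous_on_const)
  ultimately show ?thesis by auto
qed

lemma residual_in_step_kernel:
  assumes "biorthogonal n K v f"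
  shows "h - (\<Sum>j=1..n. step_functional K v j h *\<^sub>R f j) \<in> step_kernel n K v"
  unfolding step_kernel_def
  using step_functional_biorthogonal_sum[OF assms] by (auto simp: step_functional_simps(2))

text \<open>The functionals recover the coefficients of any combination of the \<open>f\<^sub>j\<close>, so these are independent
  and no nonzero combination lies in the kernel; subtracting \<open>(\<Sum>j. \<mu>\<^sub>j(x) f\<^sub>j)\<close> from \<open>x\<close> leads into the kernel.\<close>
lemma has_codimension_step_kernel:
  assumes f: "biorthogonal n K v f"
  shows "has_codimension (step_kernel n K v) n"
proof -
  have inj: "inj_on f {1..n}"
    using f by (intro inj_onI) (auto simp: biorthogonal_def, metis atLeastAtMost_iff zero_neq_one)
  have sp: "\<exists>c. x = (\<Sum>j=1..n. c j *\<^sub>R f j)" if "x \<in> span (f ` {1..n})" for x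
  proof -
    have "span (f ` {1..n}) = range (\<lambda>u. \<Sum>y\<in>f ` {1..n}. u y *\<^sub>R y)"
      by (rule span_finite) simp
    with that have "x \<in> range (\<lambda>u. \<Sum>y\<in>f ` {1..n}. u y *\<^sub>R y)" by (simp only:)
    then obtain u where "x = (\<Sum>y\<in>f ` {1..n}. u y *\<^sub>R y)" by (rule rangeE)
    then show ?thesis using inj by (auto simp: sum.reindex)
  qed
  have ind: "independent (f ` {1..n})"
    unfolding independent_explicit_finite_subsets
  proof (intro allI impI ballI)
    fix A u b
    assume A: "A \<subseteq> f ` {1..n}" "finite A" "(\<Sum>y\<in>A. u y *\<^sub>R y) = 0" and b: "b \<in> A"
    obtain i where i: "i \<in> {1..n}" "b = f i" using A b by auto
    define c where "c j = (if f j \<in> A then u (f j) else 0)" for j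
    have "(\<Sum>j=1..n. c j *\<^sub>R f j) = (\<Sum>y\<in>f ` {1..n}. (if y \<in> A then u y else 0) *\<^sub>R y)"
      using inj by (simp add: sum.reindex c_def)
    also have "\<dots> = (\<Sum>y\<in>A. u y *\<^sub>R y)"
      by (rule sum.mono_neutral_cong_right) (use A in auto)
    finally have "c i = 0"
      using step_functional_biorthogonal_sum[OF f i(1), of c] A(3) by (simp add: step_functional_simps)
    then show "u b = 0" using b i by (simp add: c_def)
  qed
  have "span (f ` {1..n}) \<inter> step_kernel n K v = {0}"
  proof -
    have "x = 0" if x: "x \<in> span (f ` {1..n})" "x \<in> step_kernel n K v" for x
    proof -
      obtain c where c: "x = (\<Sum>j=1..n. c j *\<^sub>R f j)" using sp[OF x(1)] by auto
      have "c i = 0" if "i \<in> {1..n}" for i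
        using step_functional_biorthogonal_sum[OF f that, of c] x(2) that c by (auto simp: step_kernel_def)
      then show ?thesis using c by simp
    qed
    then show ?thesis
      using subspace_0[OF subspace_step_kernel] span_zero by blast
  qed
  moreover have "\<exists>b\<in>span (f ` {1..n}). x - b \<in> step_kernel n K v" for x
  proof (rule bexI)
    show "x - (\<Sum>j=1..n. step_functional K v j x *\<^sub>R f j) \<in> step_kernel n K v"
      by (rule residual_in_step_kernel[OF f])
    show "(\<Sum>j=1..n. step_functional K v j x *\<^sub>R f j) \<in> span (f ` {1..n})"
      by (intro span_sum span_scale span_base imageI)
  qed
  moreover have "card (f ` {1..n}) = n" using inj by (simp add: card_image)
  ultimately show ?thesis
    unfolding has_codimension_def using ind by blast
qed

text \<open>Applying \<open>P\<close> to the component of \<open>h\<close> in the kernel shows that \<open>P\<close> is determined by its values on a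
  biorthogonal system \<open>e\<close>; the functions of the representation are \<open>e\<^sub>j - P e\<^sub>j\<close>.\<close>
lemma projection_representation:
  assumes e: "biorthogonal n K v e" and P: "P \<in> projections_onto (step_kernel n K v)"
  obtains f where "biorthogonal n K v f"
    "\<And>h. blinfun_apply P h = h - (\<Sum>j=1..n. step_functional K v j h *\<^sub>R f j)"
proof
  define f where "f j = e j - blinfun_apply P (e j)" for j
  have z: "step_functional K v i (blinfun_apply P h) = 0" if "i \<in> {1..n}" for i h
    using P that by (auto simp: projections_onto_def step_kernel_def)
  show "biorthogonal n K v f"
    using e z by (simp add: biorthogonal_def f_def step_functional_simps)
  fix h
  let ?r = "h - (\<Sum>j=1..n. step_functional K v j h *\<^sub>R e j)"
  have "?r = blinfun_apply P ?r"
    using residual_in_step_kernel[OF e, of h] P by (auto simp: projections_onto_def)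
  also have "\<dots> = blinfun_apply P h - (\<Sum>j=1..n. step_functional K v j h *\<^sub>R blinfun_apply P (e j))"
    by (simp add: blinfun.diff_right blinfun.sum_right blinfun.scaleR_right)
  finally show "blinfun_apply P h = h - (\<Sum>j=1..n. step_functional K v j h *\<^sub>R f j)"
    by (simp add: f_def scaleR_diff_right sum_subtractf algebra_simps)
qed

text \<open>The Daugavet phenomenon for atomless functionals.  Testing \<open>P\<close> at \<open>t\<close> against a function with value 1
  at \<open>t\<close> and cell means close to \<open>-sgn \<langle>f(t), v\<^sub>k\<rangle>\<close> makes the identity and the finite-rank part add up
  without cancellation.\<close>
lemma norm_projection_ge:
  assumes K: "0 < K"
    and P: "\<And>h. blinfun_apply P h = h - (\<Sum>j=1..n. step_functional K v j h *\<^sub>R f j)"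
  shows "1 + step_norm n K v (\<lambda>j. apply_bcontfun (f j) t) \<le> norm P"
proof -
  define p where "p k = pairing n (\<lambda>j. apply_bcontfun (f j) t) (v k)" for k
  define N where "N = step_norm n K v (\<lambda>j. apply_bcontfun (f j) t)"
  have N: "N = (\<Sum>k<K. \<bar>p k\<bar>)" by (simp add: N_def step_norm_def p_def)
  have "1 + N \<le> norm P + d" if d: "d > 0" for d
  proof -
    define e where "e = d / (N + 1)"
    have N0: "N \<ge> 0" unfolding N by (rule sum_nonneg) simp
    have e: "e > 0" "e * N \<le> d" using d N0 by (auto simp: e_def field_simps)
    obtain h :: C01 where h: "norm h \<le> 1" "apply_bcontfun h t = 1"
      "\<And>k. k < K \<Longrightarrow> \<bar>cell_mean K k h - - sgn (p k)\<bar> \<le> e"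
      using peaked_function_with_cell_means[OF K _ e(1), of "\<lambda>k. - sgn (p k)"]
      by (metis abs_minus_cancel abs_sgn_eq le_numeral_extra(4) zero_le_one)
    have "apply_bcontfun (blinfun_apply P h) t =
        1 - (\<Sum>j=1..n. apply_bcontfun (f j) t * step_functional K v j h)"
      by (simp add: P minus_bcontfun.rep_eq apply_bcontfun_sum h(2) mult.commute)
    also have "\<dots> = 1 - (\<Sum>k<K. p k * cell_mean K k h)"
      by (simp only: sum_step_functional p_def)
    finally have 1: "apply_bcontfun (blinfun_apply P h) t = 1 - (\<Sum>k<K. p k * cell_mean K k h)" .
    have "p k * cell_mean K k h \<le> - \<bar>p k\<bar> + e * \<bar>p k\<bar>" if "k < K" for k
    proof -
      have "p k * cell_mean K k h = - \<bar>p k\<bar> + p k * (cell_mean K k h - - sgn (p k))"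
        using abs_sgn[of "p k"] by (simp add: algebra_simps)
      moreover have "p k * (cell_mean K k h - - sgn (p k)) \<le> \<bar>p k\<bar> * e"
        by (rule order_trans[OF abs_ge_self]) (unfold abs_mult, intro mult_left_mono h(3) that abs_ge_zero)
      ultimately show ?thesis by (simp add: mult.commute)
    qed
    then have "(\<Sum>k<K. p k * cell_mean K k h) \<le> (\<Sum>k<K. - \<bar>p k\<bar> + e * \<bar>p k\<bar>)"
      by (intro sum_mono) auto
    also have "\<dots> = - N + e * N"
      unfolding N by (simp add: sum.distrib sum_subtractf sum_negf sum_distrib_left[symmetric] del: add_uminus_conv_diff)
    finally have "1 + N - d \<le> apply_bcontfun (blinfun_apply P h) t"
      using 1 e by linarith
    also have "\<dots> \<le> norm (blinfun_apply P h)"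
      using norm_bounded[of "blinfun_apply P h" t] by simp
    also have "\<dots> \<le> norm P * norm h" by (rule norm_blinfun)
    also have "\<dots> \<le> norm P" using h(1) by (simp add: mult_left_le)
    finally show ?thesis by simp
  qed
  then show ?thesis unfolding N_def by (rule field_le_epsilon)
qed

text \<open>Both sides are the trace of the finite-rank projection \<open>h \<mapsto> (\<Sum>j. \<mu>\<^sub>j(h) f\<^sub>j)\<close>, once computed cell by
  cell and once coordinate by coordinate.\<close>
lemma biorthogonal_trace:
  assumes "biorthogonal n K v f"
  shows "(\<Sum>k<K. cell_mean K k (\<Sum>j=1..n. v k j *\<^sub>R f j)) = real n"
proof -
  have "(\<Sum>k<K. cell_mean K k (\<Sum>j=1..n. v k j *\<^sub>R f j)) = (\<Sum>k<K. \<Sum>j=1..n. v k j * cell_mean K k (f j))"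
    by (intro sum.cong)
       (auto simp: linear_sum[OF bounded_linear.linear[OF bounded_linear_cell_mean]] cell_mean_scaleR)
  also have "\<dots> = (\<Sum>j=1..n. step_functional K v j (f j))"
    unfolding step_functional_def by (rule sum.swap)
  also have "\<dots> = (\<Sum>j=1..n. 1)"
    by (rule sum.cong) (use assms in \<open>auto simp: biorthogonal_def\<close>)
  finally show ?thesis by simp
qed

text \<open>Trace duality: estimating the trace cell by cell bounds the size of any biorthogonal system from
  below.  If the bound is sharp, every cellwise estimate is sharp, and the continuous nonnegative
  functions \<open>c\<^sub>k r - \<langle>f, v\<^sub>k\<rangle>\<close>, having mean 0 over their cells, vanish there.\<close>
lemma biorthogonal_sup_ge:
  assumes f: "biorthogonal n K v f"
    and dual: "\<And>k x. k < K \<Longrightarrow> pairing n x (v k) \<le> c k * step_norm n K v x"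
    and c: "\<And>k. k < K \<Longrightarrow> 0 \<le> c k"
    and bound: "\<And>t. step_norm n K v (\<lambda>j. apply_bcontfun (f j) t) \<le> r"
  shows "real n \<le> sum c {..<K} * r"
    and "real n = sum c {..<K} * r \<Longrightarrow> k < K \<Longrightarrow> u \<in> cell K k \<Longrightarrow>
      pairing n (\<lambda>j. apply_bcontfun (f j) (ui_of_real u)) (v k) = c k * r"
proof -
  define g where "g k = (\<Sum>j=1..n. v k j *\<^sub>R f j)" for k
  have g: "apply_bcontfun (g k) t = pairing n (\<lambda>j. apply_bcontfun (f j) t) (v k)" for k t
    by (simp add: g_def apply_bcontfun_sum pairing_def mult.commute)
  have gle: "apply_bcontfun (g k) t \<le> c k * r" if "k < K" for k t
    using dual[OF that, of "\<lambda>j. apply_bcontfun (f j) t"] mult_left_mono[OF bound[of t], of "c k"] c[OF that]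
    unfolding g by linarith
  have const: "apply_bcontfun (Bcontfun (\<lambda>t::unit_interval. b)) t = b" for b :: real and t
    by (simp add: apply_Bcontfun_C01)
  have mle: "cell_mean K k (g k) \<le> c k * r" if "k < K" for k
  proof -
    have "cell_mean K k (g k) \<le> cell_mean K k (Bcontfun (\<lambda>t. c k * r))"
      by (rule cell_mean_mono[OF that]) (use gle[OF that] in \<open>simp add: const\<close>)
    also have "\<dots> = c k * r" by (rule cell_mean_const[OF that const])
    finally show ?thesis .
  qed
  have tr: "(\<Sum>k<K. cell_mean K k (g k)) = real n"
    unfolding g_def by (rule biorthogonal_trace[OF f])
  show "real n \<le> sum c {..<K} * r"
    unfolding tr[symmetric] sum_distrib_right by (rule sum_mono) (use mle in auto)
  assume eq: "real n = sum c {..<K} * r" and k: "k < K" and u: "u \<in> cell K k"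
  have "(\<Sum>i<K. c i * r - cell_mean K i (g i)) = 0"
    using eq tr by (simp add: sum_subtractf sum_distrib_right)
  then have "c k * r - cell_mean K k (g k) = 0"
    using mle k sum_nonneg_eq_0_iff[of "{..<K}" "\<lambda>i. c i * r - cell_mean K i (g i)"] by auto
  then have 0: "cell_mean K k (Bcontfun (\<lambda>t. c k * r) - g k) = 0"
    using cell_mean_const[OF k const]
    by (simp add: linear_diff[OF bounded_linear.linear[OF bounded_linear_cell_mean[OF k]]])
  have "apply_bcontfun (Bcontfun (\<lambda>t. c k * r) - g k) (ui_of_real u) = 0"
    by (rule cell_mean_eq_0D[OF k 0 _ u]) (use gle[OF k] in \<open>simp add: minus_bcontfun.rep_eq const\<close>)
  then show "pairing n (\<lambda>j. apply_bcontfun (f j) (ui_of_real u)) (v k) = c k * r"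
    by (simp add: minus_bcontfun.rep_eq const g)
qed

text \<open>The step function with value \<open>x\<^sub>k\<close> on cell \<open>k\<close>, its indicator functions replaced by bumps.  Each
  point lies in the support of at most one bump, so the norm is controlled by a single
  \<open>step_norm n K v (x\<^sub>k)\<close>.\<close>
lemma almost_optimal_projection:
  assumes K: "0 < K" and e: "0 < e" and r: "0 \<le> r"
    and x: "\<And>i j. i \<in> {1..n} \<Longrightarrow> j \<in> {1..n} \<Longrightarrow> (\<Sum>k<K. v k i * x k j) = (if i = j then 1 else 0)"
    and xr: "\<And>k. k < K \<Longrightarrow> step_norm n K v (x k) \<le> r"
  obtains f P where "biorthogonal n K v f" "P \<in> projections_onto (step_kernel n K v)"
    "norm P \<le> 1 + (1 + e) * r"
proof -
  obtain \<phi> :: "nat \<Rightarrow> C01" where \<phi>: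
    "\<And>k t. k < K \<Longrightarrow> 0 \<le> apply_bcontfun (\<phi> k) t" "\<And>k t. k < K \<Longrightarrow> apply_bcontfun (\<phi> k) t \<le> 1 + e"
    "\<And>i k t. i < K \<Longrightarrow> k < K \<Longrightarrow> apply_bcontfun (\<phi> k) t \<noteq> 0 \<Longrightarrow> apply_bcontfun (\<phi> i) t \<noteq> 0 \<Longrightarrow> i = k"
    "\<And>i k. i < K \<Longrightarrow> k < K \<Longrightarrow> cell_mean K i (\<phi> k) = (if i = k then 1 else 0)"
    using cell_bumps[OF K e] by auto
  define f where "f j = (\<Sum>k<K. x k j *\<^sub>R \<phi> k)" for j
  have mf: "cell_mean K i (f j) = x i j" if "i < K" for i j
  proof -
    have "cell_mean K i (f j) = (\<Sum>k<K. x k j * cell_mean K i (\<phi> k))"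
      unfolding f_def
      by (simp add: linear_sum[OF bounded_linear.linear[OF bounded_linear_cell_mean[OF that]]] cell_mean_scaleR)
    also have "\<dots> = (\<Sum>k<K. if k = i then x i j else 0)"
      by (rule sum.cong) (use \<phi>(4)[OF that] in auto)
    finally show ?thesis using that by simp
  qed
  have f: "biorthogonal n K v f"
    using x by (simp add: biorthogonal_def step_functional_def mf)
  define p where "p h = h - (\<Sum>j=1..n. step_functional K v j h *\<^sub>R f j)" for h
  have "bounded_linear (\<lambda>h. h - (\<Sum>j=1..n. step_functional K v j h *\<^sub>R f j))"
    by (intro bounded_linear_sub bounded_linear_ident bounded_linear_sum
        bounded_linear_compose[OF bounded_linear_scaleR_left bounded_linear_step_functional])
  then have "bounded_linear p" by (simp add: p_def[abs_def])
  then have Pp: "blinfun_apply (Blinfun p) = p" by (rule bounded_linear_Blinfun_apply)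
  have inP: "Blinfun p \<in> projections_onto (step_kernel n K v)"
    unfolding projections_onto_def
    by (auto simp: Pp p_def residual_in_step_kernel[OF f] step_kernel_def intro!: sum.neutral)
       (use residual_in_step_kernel[OF f] in \<open>auto simp: step_kernel_def\<close>)
  have "norm (p h) \<le> (1 + (1 + e) * r) * norm h" for h
  proof (rule norm_C01_le)
    fix t
    have ht: "\<bar>apply_bcontfun h t\<bar> \<le> norm h" using norm_bounded[of h t] by simp
    have pt: "apply_bcontfun (p h) t = apply_bcontfun h t -
        (\<Sum>j=1..n. apply_bcontfun (f j) t * step_functional K v j h)"
      by (simp add: p_def minus_bcontfun.rep_eq apply_bcontfun_sum mult.commute)
    show "\<bar>apply_bcontfun (p h) t\<bar> \<le> (1 + (1 + e) * r) * norm h"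
    proof (cases "\<exists>k<K. apply_bcontfun (\<phi> k) t \<noteq> 0")
      case True
      then obtain k where k: "k < K" "apply_bcontfun (\<phi> k) t \<noteq> 0" by auto
      have ft: "apply_bcontfun (f j) t = apply_bcontfun (\<phi> k) t * x k j" for j
      proof -
        have "apply_bcontfun (f j) t = (\<Sum>i<K. if i = k then x k j * apply_bcontfun (\<phi> k) t else 0)"
          unfolding f_def apply_bcontfun_sum
          by (rule sum.cong) (use \<phi>(3)[OF _ k] in auto)
        then show ?thesis using k by simp
      qed
      have "(\<Sum>j=1..n. apply_bcontfun (f j) t * step_functional K v j h) =
          apply_bcontfun (\<phi> k) t * (\<Sum>j=1..n. x k j * step_functional K v j h)"
        by (simp add: ft sum_distrib_left mult.assoc)
      also have "\<bar>\<dots>\<bar> \<le> (1 + e) * (r * norm h)"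
        unfolding abs_mult
      proof (rule mult_mono)
        show "\<bar>apply_bcontfun (\<phi> k) t\<bar> \<le> 1 + e" using \<phi>(1,2)[OF k(1), of t] by simp
        have "\<bar>\<Sum>j=1..n. x k j * step_functional K v j h\<bar> \<le> (\<Sum>i<K. \<bar>pairing n (x k) (v i) * cell_mean K i h\<bar>)"
          unfolding sum_step_functional by (rule sum_abs)
        also have "\<dots> \<le> (\<Sum>i<K. \<bar>pairing n (x k) (v i)\<bar> * norm h)"
          by (intro sum_mono) (auto simp: abs_mult intro!: mult_left_mono cell_mean_bound)
        also have "\<dots> = step_norm n K v (x k) * norm h"
          by (simp add: step_norm_def sum_distrib_right)
        also have "\<dots> \<le> r * norm h" by (rule mult_right_mono[OF xr[OF k(1)]]) simp
        finally show "\<bar>\<Sum>j=1..n. x k j * step_functional K v j h\<bar> \<le> r * norm h" .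
      qed (use e in auto)
      finally show ?thesis
        unfolding pt using ht by (simp add: algebra_simps abs_le_iff)
    next
      case False
      then have "apply_bcontfun (f j) t = 0" for j by (simp add: f_def apply_bcontfun_sum)
      then have "apply_bcontfun (p h) t = apply_bcontfun h t" using pt by simp
      moreover have "norm h \<le> (1 + (1 + e) * r) * norm h"
        using e r mult_right_mono[of 1 "1 + (1 + e) * r" "norm h"] by simp
      ultimately show ?thesis using ht by linarith
    qed
  qed
  then have "norm (Blinfun p) \<le> 1 + (1 + e) * r"
    using e r by (intro norm_blinfun_bound) (auto simp: Pp)
  with f inP show ?thesis by (rule that)
qed

text \<open>The hypotheses are a primal-dual certificate for the minimal value \<open>r\<close>: the \<open>x\<^sub>k\<close> give the
  upper bound and the multipliers \<open>c\<^sub>k\<close> the matching lower bound.  The last claim records complementary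
  slackness for an optimal projection.\<close>
lemma step_kernel_projection_constant:
  assumes n: "0 < n" and K: "0 < K" and r: "0 < r"
    and x: "\<And>i j. i \<in> {1..n} \<Longrightarrow> j \<in> {1..n} \<Longrightarrow> (\<Sum>k<K. v k i * x k j) = (if i = j then 1 else 0)"
    and xr: "\<And>k. k < K \<Longrightarrow> step_norm n K v (x k) \<le> r"
    and dual: "\<And>k y. k < K \<Longrightarrow> pairing n y (v k) \<le> c k * step_norm n K v y"
    and c: "\<And>k. k < K \<Longrightarrow> 0 \<le> c k" "sum c {..<K} * r = real n"
  shows "has_codimension (step_kernel n K v) n"
    and "projection_constant (step_kernel n K v) = ereal (1 + r)"
    and "projection_constant_attained (step_kernel n K v) \<Longrightarrow>
      \<exists>f :: nat \<Rightarrow> C01. (\<forall>t. step_norm n K v (\<lambda>j. apply_bcontfun (f j) t) \<le> r) \<and>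
        (\<forall>k<K. \<forall>u\<in>cell K k. pairing n (\<lambda>j. apply_bcontfun (f j) (ui_of_real u)) (v k) = c k * r)"
proof -
  let ?Y = "step_kernel n K v"
  have sc: "sum c {..<K} > 0"
    using c(2) n r by (metis of_nat_0_less_iff zero_less_mult_pos2)
  obtain e P0 where e: "biorthogonal n K v e" and "P0 \<in> projections_onto ?Y"
    using almost_optimal_projection[OF K zero_less_one less_imp_le[OF r] x xr] by metis
  show "has_codimension ?Y n" by (rule has_codimension_step_kernel[OF e])
  have ex: "\<exists>f. biorthogonal n K v f \<and> (\<forall>t. step_norm n K v (\<lambda>j. apply_bcontfun (f j) t) \<le> norm P - 1)"
    if P: "P \<in> projections_onto ?Y" for P
  proof -
    obtain f where f: "biorthogonal n K v f"
      "\<And>h. blinfun_apply P h = h - (\<Sum>j=1..n. step_functional K v j h *\<^sub>R f j)"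
      using projection_representation[OF e P] by blast
    then show ?thesis using norm_projection_ge[OF K f(2)] by (intro exI[of _ f]) (auto simp: algebra_simps)
  qed
  have lower: "1 + r \<le> norm P" if P: "P \<in> projections_onto ?Y" for P
  proof -
    obtain f where f: "biorthogonal n K v f" "\<And>t. step_norm n K v (\<lambda>j. apply_bcontfun (f j) t) \<le> norm P - 1"
      using ex[OF P] by blast
    have "sum c {..<K} * r \<le> sum c {..<K} * (norm P - 1)"
      using biorthogonal_sup_ge(1)[OF f(1) dual c(1) f(2)] c(2) by simp
    then show ?thesis using sc by simp
  qed
  show pc: "projection_constant ?Y = ereal (1 + r)"
    unfolding projection_constant_def
  proof (rule antisym)
    show "ereal (1 + r) \<le> (INF P\<in>projections_onto ?Y. ereal (norm P))"
      by (rule INF_greatest) (use lower in auto)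
    show "(INF P\<in>projections_onto ?Y. ereal (norm P)) \<le> ereal (1 + r)"
    proof (rule ereal_le_epsilon2)
      fix d :: real assume d: "0 < d"
      obtain f P where P: "P \<in> projections_onto ?Y" "norm P \<le> 1 + (1 + d / r) * r"
        using almost_optimal_projection[OF K divide_pos_pos[OF d r] less_imp_le[OF r] x xr] by metis
      have "(INF P\<in>projections_onto ?Y. ereal (norm P)) \<le> ereal (norm P)"
        by (rule INF_lower[OF P(1)])
      also have "\<dots> \<le> ereal (1 + r) + ereal d"
      proof -
        have "(1 + d / r) * r = r + d" using r by (simp add: field_simps)
        then show ?thesis using P(2) by simp
      qed
      finally show "(INF P\<in>projections_onto ?Y. ereal (norm P)) \<le> ereal (1 + r) + ereal d" .
    qed
  qed
  assume "projection_constant_attained ?Y"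
  then obtain P where P: "P \<in> projections_onto ?Y" "norm P = 1 + r"
    unfolding projection_constant_attained_def pc by auto
  obtain f where f: "biorthogonal n K v f" "\<And>t. step_norm n K v (\<lambda>j. apply_bcontfun (f j) t) \<le> r"
    using ex[OF P(1)] P(2) by auto
  show "\<exists>f :: nat \<Rightarrow> C01. (\<forall>t. step_norm n K v (\<lambda>j. apply_bcontfun (f j) t) \<le> r) \<and>
        (\<forall>k<K. \<forall>u\<in>cell K k. pairing n (\<lambda>j. apply_bcontfun (f j) (ui_of_real u)) (v k) = c k * r)"
    using f(2) biorthogonal_sup_ge(2)[OF f(1) dual c(1) f(2) c(2)[symmetric]] by blast
qed

section \<open>The norm given by Rademacher averages\<close>

definition rademacher_norm :: "nat \<Rightarrow> (nat \<Rightarrow> real) \<Rightarrow> real"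
  where "rademacher_norm n x = (\<Sum>\<epsilon>\<in>sign_cube n. \<bar>pairing n x \<epsilon>\<bar>) / 2 ^ n"

lemma rademacher_norm_scale: "rademacher_norm n (\<lambda>j. a * x j) = \<bar>a\<bar> * rademacher_norm n x"
proof -
  have "pairing n (\<lambda>j. a * x j) \<epsilon> = a * pairing n x \<epsilon>" for \<epsilon>
    by (simp add: pairing_def sum_distrib_left mult.assoc)
  then show ?thesis
    by (simp add: rademacher_norm_def abs_mult sum_distrib_left[symmetric])
qed

lemma finite_sign_cube: "finite (sign_cube n)"
  unfolding sign_cube_def by (intro finite_PiE) auto

lemma card_sign_cube: "card (sign_cube n) = 2 ^ n"
  by (simp add: sign_cube_def card_PiE flip: numeral_2_eq_2)

lemma sign_cube_sq: "\<epsilon> \<in> sign_cube n \<Longrightarrow> j \<in> {1..n} \<Longrightarrow> \<epsilon> j * \<epsilon> j = 1"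
  using PiE_mem[of \<epsilon> "{1..n}" "\<lambda>_. {-1, 1}" j] by (auto simp: sign_cube_def)

lemma abs_sign_cube: "\<epsilon> \<in> sign_cube n \<Longrightarrow> j \<in> {1..n} \<Longrightarrow> \<bar>\<epsilon> j\<bar> = 1"
  using PiE_mem[of \<epsilon> "{1..n}" "\<lambda>_. {-1, 1}" j] by (auto simp: sign_cube_def)

lemma sign_cube_eqI:
  "\<epsilon> \<in> sign_cube n \<Longrightarrow> \<omega> \<in> sign_cube n \<Longrightarrow> (\<And>j. j \<in> {1..n} \<Longrightarrow> \<epsilon> j = \<omega> j) \<Longrightarrow> \<epsilon> = \<omega>"
  unfolding sign_cube_def by (rule PiE_ext)

lemma pairing_self: "\<omega> \<in> sign_cube n \<Longrightarrow> pairing n \<omega> \<omega> = real n"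
  unfolding pairing_def by (subst sum.cong[OF refl sign_cube_sq]) auto

text \<open>Coordinatewise multiplication by a sign vector is an involution of the cube.  The product must be
  restricted to \<open>{1..n}\<close> because members of the cube are undefined outside that set.\<close>
lemma sum_sign_cube_mult:
  assumes \<omega>: "\<omega> \<in> sign_cube n"
  shows "(\<Sum>\<epsilon>\<in>sign_cube n. F (\<lambda>j\<in>{1..n}. \<omega> j * \<epsilon> j)) = (\<Sum>\<epsilon>\<in>sign_cube n. F \<epsilon>)"
proof (rule sum.reindex_bij_witness[where i = "\<lambda>\<epsilon>. \<lambda>j\<in>{1..n}. \<omega> j * \<epsilon> j" and j = "\<lambda>\<epsilon>. \<lambda>j\<in>{1..n}. \<omega> j * \<epsilon> j"])
  fix \<epsilon> assume \<epsilon>: "\<epsilon> \<in> sign_cube n"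
  show 1: "(\<lambda>j\<in>{1..n}. \<omega> j * \<epsilon> j) \<in> sign_cube n"
    using \<omega> \<epsilon> by (fastforce simp: sign_cube_def PiE_iff)
  show 2: "(\<lambda>j\<in>{1..n}. \<omega> j * (\<lambda>j\<in>{1..n}. \<omega> j * \<epsilon> j) j) = \<epsilon>"
  proof (rule ext)
    fix j
    show "(\<lambda>j\<in>{1..n}. \<omega> j * (\<lambda>j\<in>{1..n}. \<omega> j * \<epsilon> j) j) j = \<epsilon> j"
    proof (cases "j \<in> {1..n}")
      case True
      then show ?thesis using sign_cube_sq[OF \<omega> True] by (simp add: mult.assoc[symmetric])
    next
      case False
      then show ?thesis using \<epsilon> by (auto simp: sign_cube_def PiE_iff extensional_def)
    qed
  qed
  show "(\<lambda>j\<in>{1..n}. \<omega> j * \<epsilon> j) \<in> sign_cube n" by (rule 1)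
  show "(\<lambda>j\<in>{1..n}. \<omega> j * (\<lambda>j\<in>{1..n}. \<omega> j * \<epsilon> j) j) = \<epsilon>" by (rule 2)
qed simp

text \<open>For \<open>i \<noteq> j\<close>, changing the sign of the \<open>i\<close>-th coordinate changes the sign of the sum.\<close>
lemma sum_sign_cube_orthogonal:
  assumes i: "i \<in> {1..n}" and j: "j \<in> {1..n}"
  shows "(\<Sum>\<epsilon>\<in>sign_cube n. \<epsilon> i * \<epsilon> j) = (if i = j then 2 ^ n else 0)"
proof (cases "i = j")
  case True
  then have "(\<Sum>\<epsilon>\<in>sign_cube n. \<epsilon> i * \<epsilon> j) = (\<Sum>\<epsilon>\<in>sign_cube n. 1)"
    by (intro sum.cong) (use sign_cube_sq[OF _ j] in auto)
  with True show ?thesis by (simp add: card_sign_cube)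
next
  case False
  define \<omega> :: "nat \<Rightarrow> real" where "\<omega> = (\<lambda>k\<in>{1..n}. if k = i then -1 else 1)"
  have \<omega>: "\<omega> \<in> sign_cube n" by (auto simp: \<omega>_def sign_cube_def PiE_iff)
  have "(\<Sum>\<epsilon>\<in>sign_cube n. \<epsilon> i * \<epsilon> j) = (\<Sum>\<epsilon>\<in>sign_cube n. - (\<epsilon> i * \<epsilon> j))"
    using sum_sign_cube_mult[OF \<omega>, of "\<lambda>\<epsilon>. \<epsilon> i * \<epsilon> j"] i j False by (simp add: \<omega>_def)
  with False show ?thesis by (simp add: sum_negf)
qed

text \<open>Testing \<open>\<langle>x, \<epsilon>\<rangle>\<close> against \<open>\<epsilon>\<^sub>j\<close> singles out the coordinate \<open>x\<^sub>j\<close>.\<close>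
lemma rademacher_norm_ge_coordinate:
  assumes "j \<in> {1..n}"
  shows "\<bar>x j\<bar> \<le> rademacher_norm n x"
proof -
  have "2 ^ n * \<bar>x j\<bar> = \<bar>\<Sum>i=1..n. x i * (\<Sum>\<epsilon>\<in>sign_cube n. \<epsilon> i * \<epsilon> j)\<bar>"
    using assms by (simp add: sum_sign_cube_orthogonal if_distrib abs_mult mult.commute cong: if_cong)
  also have "(\<Sum>i=1..n. x i * (\<Sum>\<epsilon>\<in>sign_cube n. \<epsilon> i * \<epsilon> j)) = (\<Sum>\<epsilon>\<in>sign_cube n. pairing n x \<epsilon> * \<epsilon> j)"
    unfolding pairing_def sum_distrib_left sum_distrib_right by (subst sum.swap) (simp add: mult.assoc)
  also have "\<bar>\<dots>\<bar> \<le> (\<Sum>\<epsilon>\<in>sign_cube n. \<bar>pairing n x \<epsilon> * \<epsilon> j\<bar>)" by (rule sum_abs)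
  also have "\<dots> = (\<Sum>\<epsilon>\<in>sign_cube n. \<bar>pairing n x \<epsilon>\<bar>)"
    by (rule sum.cong) (simp_all add: abs_mult abs_sign_cube[OF _ assms])
  finally show ?thesis by (simp add: rademacher_norm_def field_simps)
qed

definition rademacher_mean :: "nat \<Rightarrow> real"
  where "rademacher_mean n = rademacher_norm n (\<lambda>_. 1)"

lemma pairing_sign_mult:
  "pairing n x (\<lambda>j\<in>{1..n}. \<omega> j * \<epsilon> j) = pairing n (\<lambda>j. x j * \<omega> j) \<epsilon>"
  unfolding pairing_def by (rule sum.cong) auto

lemma rademacher_norm_sign_mult:
  "\<omega> \<in> sign_cube n \<Longrightarrow> rademacher_norm n (\<lambda>j. x j * \<omega> j) = rademacher_norm n x"
  unfolding rademacher_norm_def pairing_sign_mult[symmetric]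
  by (subst sum_sign_cube_mult) auto

lemma rademacher_norm_sign:
  "\<omega> \<in> sign_cube n \<Longrightarrow> rademacher_norm n \<omega> = rademacher_mean n"
  using rademacher_norm_sign_mult[of \<omega> n "\<lambda>_. 1"] by (simp add: rademacher_mean_def)

text \<open>By symmetry under transpositions the sum does not depend on \<open>i\<close>, and adding it up over all
  coordinates produces \<open>sgn(S) S = \<bar>S\<bar>\<close> for \<open>S = (\<Sum>j. \<epsilon>\<^sub>j)\<close>.\<close>
lemma sign_correlation_coordinate:
  assumes i: "i \<in> {1..n}"
  shows "real n * (\<Sum>\<epsilon>\<in>sign_cube n. sgn (pairing n (\<lambda>_. 1) \<epsilon>) * \<epsilon> i) = 2 ^ n * rademacher_mean n"
proof -
  define m where "m j = (\<Sum>\<epsilon>\<in>sign_cube n. sgn (pairing n (\<lambda>_. 1) \<epsilon>) * \<epsilon> j)" for j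
  have eq: "m j = m i" if j: "j \<in> {1..n}" for j
  proof -
    define \<tau> where "\<tau> = Transposition.transpose i j"
    have \<tau>: "\<tau> permutes {1..n}" unfolding \<tau>_def using i j by (intro permutes_swap_id)
    have inv: "(\<epsilon> \<circ> \<tau>) \<circ> \<tau> = \<epsilon>" for \<epsilon> :: "nat \<Rightarrow> real" by (auto simp: \<tau>_def fun_eq_iff)
    have mem: "\<epsilon> \<circ> \<tau> \<in> sign_cube n" if "\<epsilon> \<in> sign_cube n" for \<epsilon>
      using that permutes_in_image[OF \<tau>] permutes_not_in[OF \<tau>]
      by (auto simp: sign_cube_def PiE_iff extensional_def)
    have p: "pairing n (\<lambda>_. 1) (\<epsilon> \<circ> \<tau>) = pairing n (\<lambda>_. 1) \<epsilon>" for \<epsilon>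
      unfolding pairing_def using sum.permute[OF \<tau>, of \<epsilon>] by (simp add: o_def)
    show ?thesis unfolding m_def
      by (rule sum.reindex_bij_witness[where i = "\<lambda>\<epsilon>. \<epsilon> \<circ> \<tau>" and j = "\<lambda>\<epsilon>. \<epsilon> \<circ> \<tau>"])
         (auto simp: inv mem p, simp add: \<tau>_def)
  qed
  have "real n * m i = (\<Sum>j=1..n. m j)" using eq by simp
  also have "\<dots> = (\<Sum>\<epsilon>\<in>sign_cube n. sgn (pairing n (\<lambda>_. 1) \<epsilon>) * pairing n (\<lambda>_. 1) \<epsilon>)"
    unfolding m_def pairing_def by (subst sum.swap) (simp add: sum_distrib_left)
  also have "\<dots> = 2 ^ n * rademacher_mean n"
    by (simp add: rademacher_mean_def rademacher_norm_def abs_sgn mult.commute)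
  finally show ?thesis by (simp add: m_def)
qed

text \<open>The linear functional \<open>x \<mapsto> E (sgn \<langle>\<omega>, \<epsilon>\<rangle> \<langle>x, \<epsilon>\<rangle>)\<close> is a subgradient of the Rademacher norm
  at \<open>\<omega>\<close>, and the symmetries of the cube show that it is a multiple of \<open>\<langle>x, \<omega>\<rangle>\<close>.\<close>
lemma sign_correlation:
  assumes n: "0 < n" and \<omega>: "\<omega> \<in> sign_cube n"
  shows "(\<Sum>\<epsilon>\<in>sign_cube n. sgn (pairing n \<omega> \<epsilon>) * pairing n x \<epsilon>) =
    2 ^ n * (rademacher_mean n / real n * pairing n x \<omega>)"
proof -
  let ?F = "\<lambda>\<epsilon>. sgn (pairing n \<omega> \<epsilon>) * pairing n x \<epsilon>"
  have sq: "pairing n (\<lambda>j. \<omega> j * \<omega> j) \<epsilon> = pairing n (\<lambda>_. 1) \<epsilon>" for \<epsilon>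
    unfolding pairing_def by (rule sum.cong) (auto simp: sign_cube_sq[OF \<omega>])
  have "(\<Sum>\<epsilon>\<in>sign_cube n. ?F \<epsilon>) = (\<Sum>\<epsilon>\<in>sign_cube n. ?F (\<lambda>j\<in>{1..n}. \<omega> j * \<epsilon> j))"
    by (rule sum_sign_cube_mult[OF \<omega>, symmetric])
  also have "\<dots> = (\<Sum>\<epsilon>\<in>sign_cube n. \<Sum>j=1..n. x j * \<omega> j * (sgn (pairing n (\<lambda>_. 1) \<epsilon>) * \<epsilon> j))"
    unfolding pairing_sign_mult sq
    by (simp add: pairing_def[of n "\<lambda>j. x j * \<omega> j"] sum_distrib_left mult.assoc mult.left_commute)
  also have "\<dots> = (\<Sum>j=1..n. x j * \<omega> j * (\<Sum>\<epsilon>\<in>sign_cube n. sgn (pairing n (\<lambda>_. 1) \<epsilon>) * \<epsilon> j))"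
    by (subst sum.swap) (simp add: sum_distrib_left)
  also have "\<dots> = (\<Sum>j=1..n. x j * \<omega> j * (2 ^ n * rademacher_mean n / real n))"
    by (intro sum.cong refl arg_cong2[where f = "(*)"])
       (use n sign_correlation_coordinate in \<open>simp add: field_simps\<close>)
  finally show ?thesis
    by (simp add: pairing_def sum_distrib_right[symmetric] sum_divide_distrib[symmetric] mult.commute)
qed

lemma rademacher_norm_ge_pairing:
  assumes n: "0 < n" and \<omega>: "\<omega> \<in> sign_cube n"
  shows "rademacher_mean n / real n * pairing n x \<omega> \<le> rademacher_norm n x"
proof -
  have "2 ^ n * (rademacher_mean n / real n * pairing n x \<omega>) \<le> (\<Sum>\<epsilon>\<in>sign_cube n. \<bar>pairing n x \<epsilon>\<bar>)"
    unfolding sign_correlation[OF assms, symmetric]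
    by (intro sum_mono) (auto simp: sgn_if)
  then show ?thesis by (simp add: rademacher_norm_def field_simps)
qed

text \<open>In the equality case of \<open>rademacher_norm_ge_pairing\<close>, \<open>\<bar>\<langle>x, \<epsilon>\<rangle>\<bar> = sgn \<langle>\<omega>, \<epsilon>\<rangle> \<langle>x, \<epsilon>\<rangle>\<close> for every sign
  vector \<open>\<epsilon>\<close>, so \<open>x\<close> annihilates every \<open>\<epsilon>\<close> orthogonal to \<open>\<omega>\<close>.  For even \<open>n\<close> these \<open>\<epsilon>\<close> agree with \<open>\<omega>\<close> on
  exactly half of the coordinates; exchanging one coordinate of the half for another shows that
  \<open>x\<^sub>j \<omega>\<^sub>j\<close> does not depend on \<open>j\<close>.  For odd \<open>n\<close> no such \<open>\<epsilon>\<close> exists and the norm is linear near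
  \<open>\<omega>\<close>.\<close>
lemma rademacher_norm_equality:
  assumes n: "0 < n" "even n" and \<omega>: "\<omega> \<in> sign_cube n"
    and le: "rademacher_norm n x \<le> rademacher_mean n / real n * pairing n x \<omega>"
  obtains c where "\<And>j. j \<in> {1..n} \<Longrightarrow> x j = c * \<omega> j"
proof -
  have z: "pairing n x \<epsilon> = 0" if \<epsilon>: "\<epsilon> \<in> sign_cube n" "pairing n \<omega> \<epsilon> = 0" for \<epsilon>
  proof -
    let ?F = "\<lambda>\<epsilon>. \<bar>pairing n x \<epsilon>\<bar> - sgn (pairing n \<omega> \<epsilon>) * pairing n x \<epsilon>"
    have F: "0 \<le> ?F \<epsilon>" for \<epsilon> by (auto simp: sgn_if)
    have "sum ?F (sign_cube n) \<le> 0"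
      using le unfolding sum_subtractf sign_correlation[OF n(1) \<omega>] by (simp add: rademacher_norm_def field_simps)
    then have "sum ?F (sign_cube n) = 0" using sum_nonneg[of "sign_cube n" ?F] F by simp
    then have "?F \<epsilon> = 0"
      using sum_nonneg_eq_0_iff[OF finite_sign_cube, of n ?F] F \<epsilon>(1) by blast
    then show ?thesis using \<epsilon>(2) by simp
  qed
  define y where "y j = x j * \<omega> j" for j
  have half: "2 * sum y A = sum y {1..n}" if A: "A \<subseteq> {1..n}" "2 * card A = n" for A
  proof -
    define \<epsilon> where "\<epsilon> = (\<lambda>j\<in>{1..n}. if j \<in> A then \<omega> j else - \<omega> j)"
    have \<epsilon>: "\<epsilon> \<in> sign_cube n" using \<omega> by (auto simp: \<epsilon>_def sign_cube_def PiE_iff)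
    have p: "pairing n w \<epsilon> = 2 * (\<Sum>j\<in>A. w j * \<omega> j) - pairing n w \<omega>" for w
    proof -
      have "pairing n w \<epsilon> = (\<Sum>j=1..n. 2 * (if j \<in> A then w j * \<omega> j else 0) - w j * \<omega> j)"
        unfolding pairing_def \<epsilon>_def by (rule sum.cong) auto
      also have "\<dots> = 2 * (\<Sum>j=1..n. if j \<in> A then w j * \<omega> j else 0) - pairing n w \<omega>"
        by (simp add: sum_subtractf sum_distrib_left pairing_def)
      also have "(\<Sum>j=1..n. if j \<in> A then w j * \<omega> j else 0) = (\<Sum>j\<in>A. w j * \<omega> j)"
        using A(1) by (simp add: sum.inter_restrict[symmetric] Int_absorb1)
      finally show ?thesis .
    qed
    have "(\<Sum>j\<in>A. \<omega> j * \<omega> j) = (\<Sum>j\<in>A. 1)"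
      by (rule sum.cong) (use A sign_cube_sq[OF \<omega>] in auto)
    then have "pairing n \<omega> \<epsilon> = 0"
      unfolding p pairing_self[OF \<omega>] using A(2) by simp
    from z[OF \<epsilon> this] show ?thesis unfolding p by (simp add: y_def pairing_def)
  qed
  have eq: "y i = y j" if ij: "i \<in> {1..n}" "j \<in> {1..n}" "i \<noteq> j" for i j
  proof -
    have "n div 2 - 1 \<le> card ({1..n} - {i, j})"
      using ij by (simp add: card_Diff_subset)
    then obtain A where A: "A \<subseteq> {1..n} - {i, j}" "card A = n div 2 - 1" "finite A"
      by (rule obtain_subset_with_card_n)
    have ge: "n div 2 \<ge> 1" using n by (auto elim: evenE)
    have "2 * sum y (insert k A) = sum y {1..n}" if "k = i \<or> k = j" for k
    proof (rule half)
      show "insert k A \<subseteq> {1..n}" using A that ij by auto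
      have "k \<notin> A" using A that by auto
      then show "2 * card (insert k A) = n" using A ge n by simp
    qed
    then have "sum y (insert i A) = sum y (insert j A)" by (metis mult_cancel_left zero_neq_numeral)
    moreover have "i \<notin> A" "j \<notin> A" using A by auto
    ultimately show ?thesis using A(3) by simp
  qed
  show ?thesis
  proof (rule that[of "y 1"])
    fix j assume j: "j \<in> {1..n}"
    then have "y 1 = y j" using eq[of 1 j] n by (cases "j = 1") auto
    then show "x j = y 1 * \<omega> j"
      using sign_cube_sq[OF \<omega> j] by (simp add: y_def mult.assoc)
  qed
qed

lemma rademacher_mean_expectation:
  "rademacher_mean n =
    measure_pmf.expectation (sign_measure n) (\<lambda>\<omega>. \<bar>\<Sum>j=1..n. rademacher j \<omega>\<bar>)"
proof -
  have "sign_cube n \<noteq> {}" using card_sign_cube[of n] by force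
  then show ?thesis
    by (simp add: sign_measure_def integral_pmf_of_set finite_sign_cube card_sign_cube
        rademacher_mean_def rademacher_norm_def pairing_def rademacher_def)
qed

text \<open>Sign vectors are grouped by the number \<open>l\<close> of entries \<open>-1\<close>.  The middle term \<open>l = n / 2\<close> vanishes and
  \<open>l \<mapsto> n - l\<close> identifies the two remaining halves, whence the exponent \<open>n - 1\<close> in the definition.\<close>
lemma beta_const_eq_rademacher_mean:
  assumes "even n" "0 < n"
  shows "beta_const n = rademacher_mean n"
proof -
  obtain m where m: "n = 2 * m" "0 < m" using assms by (auto elim: evenE)
  define g where "g l = real (n choose l) * \<bar>real n - 2 * real l\<bar>" for l
  have "(\<Sum>\<epsilon>\<in>sign_cube n. \<bar>pairing n (\<lambda>_. 1) \<epsilon>\<bar>) = (\<Sum>A\<in>Pow {1..n}. \<bar>real n - 2 * real (card A)\<bar>)"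
  proof (rule sum.reindex_bij_witness[where j = "\<lambda>\<epsilon>. {j\<in>{1..n}. \<epsilon> j = -1}"
        and i = "\<lambda>A. \<lambda>j\<in>{1..n}. if j \<in> A then -1 else 1"])
    fix \<epsilon> assume \<epsilon>: "\<epsilon> \<in> sign_cube n"
    show "(\<lambda>j\<in>{1..n}. if j \<in> {j\<in>{1..n}. \<epsilon> j = -1} then -1 else 1) = \<epsilon>"
      by (rule ext) (use \<epsilon> in \<open>auto simp: sign_cube_def PiE_iff extensional_def\<close>)
    have "pairing n (\<lambda>_. 1) \<epsilon> = (\<Sum>j=1..n. 1 - 2 * (if \<epsilon> j = -1 then 1 else 0))"
      unfolding pairing_def by (rule sum.cong) (use \<epsilon> in \<open>auto simp: sign_cube_def PiE_iff\<close>)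
    also have "\<dots> = real n - 2 * (\<Sum>j=1..n. if \<epsilon> j = -1 then 1 else 0)"
      by (simp add: sum_subtractf sum_distrib_left)
    also have "(\<Sum>j=1..n. if \<epsilon> j = -1 then 1 else 0 :: real) = real (card {j\<in>{1..n}. \<epsilon> j = -1})"
      by (simp add: sum.inter_filter[symmetric])
    finally show "\<bar>real n - 2 * real (card {j\<in>{1..n}. \<epsilon> j = -1})\<bar> = \<bar>pairing n (\<lambda>_. 1) \<epsilon>\<bar>" by simp
  qed (auto simp: sign_cube_def PiE_iff)
  also have "\<dots> = (\<Sum>l\<in>{..n}. \<Sum>A\<in>{A\<in>Pow {1..n}. card A = l}. \<bar>real n - 2 * real (card A)\<bar>)"
    by (rule sum.group[symmetric]) (auto simp: card_mono[of "{1..n}", simplified])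
  also have "\<dots> = (\<Sum>l\<in>{..n}. g l)"
    by (rule sum.cong) (auto simp: g_def n_subsets[of "{1..n}", simplified] Pow_def)
  also have "{..n} = {..<m} \<union> {m} \<union> {m<..n}" using m by auto
  also have "sum g \<dots> = sum g {..<m} + g m + sum g {m<..n}"
    by (subst sum.union_disjoint; auto)+
  also have "g m = 0" by (simp add: g_def m)
  also have "sum g {m<..n} = sum g {..<m}"
    by (rule sum.reindex_bij_witness[where i = "\<lambda>l. n - l" and j = "\<lambda>l. n - l"])
       (auto simp: m g_def of_nat_diff binomial_symmetric[symmetric])
  also have "sum g {..<m} = C_const n"
    unfolding C_const_def g_def by (rule sum.cong) (auto simp: m)
  finally have "rademacher_mean n = 2 * C_const n / 2 ^ n"
    by (simp add: rademacher_mean_def rademacher_norm_def)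
  also have "\<dots> = beta_const n"
    using assms(2) by (cases n) (auto simp: beta_const_def)
  finally show ?thesis by simp
qed

section \<open>Mixing sign vectors and unit vectors\<close>

text \<open>The first \<open>2 ^ n\<close> cells carry the vectors \<open>W k\<close>, scaled by \<open>a\<close>; cell \<open>2 ^ n + j - 1\<close> carries the
  \<open>j\<close>-th unit vector, scaled by \<open>b\<close>.  The same shape, with different scalars, serves for the step functionals and
  for the optimal step function.\<close>
definition mixed_step :: "nat \<Rightarrow> (nat \<Rightarrow> nat \<Rightarrow> real) \<Rightarrow> real \<Rightarrow> real \<Rightarrow> nat \<Rightarrow> nat \<Rightarrow> real"
  where "mixed_step n W a b k j =
    (if k < 2 ^ n then a * W k j else if Suc k = 2 ^ n + j then b else 0)"

lemma sum_cells_split: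
  fixes f :: "nat \<Rightarrow> real"
  shows "sum f {..<m + n} = sum f {..<m} + (\<Sum>j=1..n. f (m + j - 1))"
proof -
  have "sum f {..<m + n} = sum f {..<m} + sum f {m..<m + n}"
    by (simp add: sum.atLeastLessThan_concat[of 0 m "m + n" f, simplified atLeast0LessThan])
  also have "sum f {m..<m + n} = (\<Sum>j=1..n. f (m + j - 1))"
    by (rule sum.reindex_bij_witness[where i = "\<lambda>j. m + j - 1" and j = "\<lambda>k. Suc k - m"]) auto
  finally show ?thesis .
qed

lemma pairing_mixed_step:
  "k < 2 ^ n \<Longrightarrow> pairing n x (mixed_step n W a b k) = a * pairing n x (W k)"
  "j \<in> {1..n} \<Longrightarrow> pairing n x (mixed_step n W a b (2 ^ n + j - 1)) = b * x j"
proof -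
  show "pairing n x (mixed_step n W a b k) = a * pairing n x (W k)" if "k < 2 ^ n"
    using that by (simp add: pairing_def mixed_step_def sum_distrib_left mult.left_commute)
  show "pairing n x (mixed_step n W a b (2 ^ n + j - 1)) = b * x j" if "j \<in> {1..n}"
  proof -
    have "pairing n x (mixed_step n W a b (2 ^ n + j - 1)) = (\<Sum>i=1..n. if i = j then b * x j else 0)"
      unfolding pairing_def mixed_step_def by (rule sum.cong) (use that in auto)
    then show ?thesis using that by simp
  qed
qed

lemma step_norm_mixed_step:
  assumes W: "bij_betw W {..<2 ^ n} (sign_cube n)" and s: "0 \<le> s" "s \<le> 1"
  shows "step_norm n (2 ^ n + n) (mixed_step n W ((1 - s) / 2 ^ n) s) x =
    (1 - s) * rademacher_norm n x + s * (\<Sum>j=1..n. \<bar>x j\<bar>)"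
proof -
  let ?v = "mixed_step n W ((1 - s) / 2 ^ n) s"
  have "(\<Sum>k<2 ^ n. \<bar>pairing n x (?v k)\<bar>) = (\<Sum>k<2 ^ n. (1 - s) / 2 ^ n * \<bar>pairing n x (W k)\<bar>)"
    by (rule sum.cong) (use s in \<open>auto simp: pairing_mixed_step abs_mult\<close>)
  also have "\<dots> = (\<Sum>\<epsilon>\<in>sign_cube n. (1 - s) / 2 ^ n * \<bar>pairing n x \<epsilon>\<bar>)"
    by (rule sum.reindex_bij_betw[OF W])
  also have "\<dots> = (1 - s) * rademacher_norm n x"
    by (simp add: rademacher_norm_def sum_distrib_left[symmetric] sum_divide_distrib[symmetric])
  finally have 1: "(\<Sum>k<2 ^ n. \<bar>pairing n x (?v k)\<bar>) = (1 - s) * rademacher_norm n x" .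
  have 2: "(\<Sum>j=1..n. \<bar>pairing n x (?v (2 ^ n + j - 1))\<bar>) = s * (\<Sum>j=1..n. \<bar>x j\<bar>)"
    unfolding sum_distrib_left
    by (rule sum.cong) (use s pairing_mixed_step(2) in \<open>auto simp: abs_mult\<close>)
  show ?thesis
    unfolding step_norm_def sum_cells_split 1 2 ..
qed

text \<open>In the mixed norm every sign vector has norm \<open>B\<close> and every unit vector norm 1.  Both kinds of vectors are
  extremal for their own pairing, which yields the multipliers \<open>c\<^sub>k\<close>; their sum is \<open>n / r\<close>.\<close>
lemma nonattained_step_kernel:
  assumes n: "0 < n" "even n" and \<beta>: "0 < rademacher_mean n" and s: "0 \<le> s" "s < 1"
  defines "B \<equiv> (1 - s) * rademacher_mean n + s * real n"
  defines "r \<equiv> 1 / ((1 - s) / B + s)"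
  shows "\<exists>Y :: C01 set. subspace Y \<and> closed Y \<and> has_codimension Y n \<and>
        projection_constant Y = ereal (1 + r) \<and> \<not> projection_constant_attained Y"
proof -
  obtain W :: "nat \<Rightarrow> nat \<Rightarrow> real" where W: "bij_betw W {..<2 ^ n} (sign_cube n)"
    using ex_bij_betw_nat_finite[OF finite_sign_cube[of n]]
    by (auto simp: card_sign_cube atLeast0LessThan)
  have Wk: "W k \<in> sign_cube n" if "k < 2 ^ n" for k
    using W that by (auto simp: bij_betw_def)
  define K where "K = 2 ^ n + n"
  define v where "v = mixed_step n W ((1 - s) / 2 ^ n) s"
  define x where "x = mixed_step n W (r / B) r"
  define c where "c k = (if k < 2 ^ n then (1 - s) * real n / (2 ^ n * B) else s)" for k :: nat
  have K: "0 < K" using n by (simp add: K_def)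
  have B: "0 < B" using n \<beta> s by (simp add: B_def add_pos_nonneg)
  have den: "0 < (1 - s) / B + s" using B s by (simp add: add_pos_nonneg)
  then have r: "0 < r" by (simp add: r_def)
  have rB: "r * ((1 - s) / B + s) = 1" using den by (simp add: r_def)
  have N: "step_norm n K v y = (1 - s) * rademacher_norm n y + s * (\<Sum>j=1..n. \<bar>y j\<bar>)" for y
    unfolding K_def v_def by (rule step_norm_mixed_step[OF W]) (use s in auto)
  have l1: "pairing n y \<omega> \<le> (\<Sum>j=1..n. \<bar>y j\<bar>)" if "\<omega> \<in> sign_cube n" for y \<omega>
    unfolding pairing_def
    by (rule sum_mono, rule order_trans[OF abs_ge_self]) (simp add: abs_mult abs_sign_cube[OF that])
  have dualW: "B / real n * pairing n y \<omega> \<le> step_norm n K v y" if \<omega>: "\<omega> \<in> sign_cube n" for y \<omega>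
  proof -
    have "B / real n * pairing n y \<omega> =
        (1 - s) * (rademacher_mean n / real n * pairing n y \<omega>) + s * pairing n y \<omega>"
      using n by (simp add: B_def field_simps)
    also have "\<dots> \<le> step_norm n K v y"
      unfolding N using s by (intro add_mono mult_left_mono rademacher_norm_ge_pairing[OF n(1) \<omega>] l1[OF \<omega>]) auto
    finally show ?thesis .
  qed
  have dualE: "y j \<le> step_norm n K v y" if j: "j \<in> {1..n}" for y j
  proof -
    have "y j \<le> (1 - s) * \<bar>y j\<bar> + s * \<bar>y j\<bar>" by (simp add: algebra_simps)
    also have "\<dots> \<le> step_norm n K v y"
      unfolding N using s j
      by (intro add_mono mult_left_mono rademacher_norm_ge_coordinate member_le_sum[of j "{1..n}"]) auto
    finally show ?thesis .
  qed
  have index_cases: "(k < 2 ^ n \<Longrightarrow> Q k) \<Longrightarrow> (\<And>j. j \<in> {1..n} \<Longrightarrow> Q (2 ^ n + j - 1)) \<Longrightarrow> Q k"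
    if "k < K" for k Q
  proof (cases "k < 2 ^ n")
    case False
    then have "Suc k - 2 ^ n \<in> {1..n}" "2 ^ n + (Suc k - 2 ^ n) - 1 = k"
      using \<open>k < K\<close> by (auto simp: K_def)
    then show "(\<And>j. j \<in> {1..n} \<Longrightarrow> Q (2 ^ n + j - 1)) \<Longrightarrow> Q k" by metis
  qed
  have c_nonneg: "0 \<le> c k" for k using s B by (simp add: c_def)
  have csum: "sum c {..<K} * r = real n"
  proof -
    have "(\<Sum>j=1..n. c (2 ^ n + j - 1)) = (\<Sum>j=1..n. s)"
      by (rule sum.cong) (auto simp: c_def)
    moreover have "(\<Sum>k<2 ^ n. c k) = real n * ((1 - s) / B)"
      by (simp add: c_def)
    ultimately have "sum c {..<K} = real n * ((1 - s) / B + s)"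
      unfolding K_def sum_cells_split by (simp add: distrib_left)
    then have "sum c {..<K} * r = real n * (r * ((1 - s) / B + s))" by (simp only: mult.assoc mult.commute[of r])
    then show ?thesis by (simp only: rB mult_1_right)
  qed
  have dual: "pairing n y (v k) \<le> c k * step_norm n K v y" if "k < K" for k y
  proof (rule index_cases[OF that])
    assume k: "k < 2 ^ n"
    have "pairing n y (v k) = (1 - s) * real n / (2 ^ n * B) * (B / real n * pairing n y (W k))"
      using k n B by (simp add: v_def pairing_mixed_step)
    also have "\<dots> \<le> c k * step_norm n K v y"
      using k s B dualW[OF Wk[OF k]] by (simp add: c_def mult_left_mono del: times_divide_eq_left)
    finally show "pairing n y (v k) \<le> c k * step_norm n K v y" .
  next
    fix j assume j: "j \<in> {1..n}"
    then have "\<not> 2 ^ n + j - 1 < (2 ^ n :: nat)" by auto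
    then have "c (2 ^ n + j - 1) = s" by (simp only: c_def if_False)
    then show "pairing n y (v (2 ^ n + j - 1)) \<le> c (2 ^ n + j - 1) * step_norm n K v y"
      using mult_left_mono[OF dualE[OF j, of y] s(1)]
      by (simp only: v_def pairing_mixed_step(2)[OF j])
  qed
  have bio: "(\<Sum>k<K. v k i * x k j) = (if i = j then 1 else 0)" if ij: "i \<in> {1..n}" "j \<in> {1..n}" for i j
  proof -
    have "(\<Sum>k<2 ^ n. v k i * x k j) = (\<Sum>k<2 ^ n. (1 - s) / 2 ^ n * (r / B) * (W k i * W k j))"
      by (rule sum.cong) (auto simp: v_def x_def mixed_step_def)
    also have "\<dots> = (\<Sum>\<epsilon>\<in>sign_cube n. (1 - s) / 2 ^ n * (r / B) * (\<epsilon> i * \<epsilon> j))"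
      by (rule sum.reindex_bij_betw[OF W])
    also have "\<dots> = (1 - s) / 2 ^ n * (r / B) * (\<Sum>\<epsilon>\<in>sign_cube n. \<epsilon> i * \<epsilon> j)"
      by (simp add: sum_distrib_left)
    also have "\<dots> = (if i = j then r * ((1 - s) / B) else 0)"
      unfolding sum_sign_cube_orthogonal[OF ij] by simp
    finally have 1: "(\<Sum>k<2 ^ n. v k i * x k j) = (if i = j then r * ((1 - s) / B) else 0)" .
    have "(\<Sum>l=1..n. v (2 ^ n + l - 1) i * x (2 ^ n + l - 1) j) =
        (\<Sum>l=1..n. if l = i then (if i = j then r * s else 0) else 0)"
      by (rule sum.cong) (auto simp: v_def x_def mixed_step_def)
    then have 2: "(\<Sum>l=1..n. v (2 ^ n + l - 1) i * x (2 ^ n + l - 1) j) = (if i = j then r * s else 0)"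
      using ij by simp
    show ?thesis
      unfolding K_def sum_cells_split 1 2 using rB by (simp add: distrib_left)
  qed
  have xr: "step_norm n K v (x k) \<le> r" if "k < K" for k
  proof (rule index_cases[OF that])
    assume k: "k < 2 ^ n"
    have "x k = (\<lambda>j. r / B * W k j)" using k by (simp add: x_def mixed_step_def fun_eq_iff)
    moreover have "rademacher_norm n (\<lambda>j. r / B * W k j) = r / B * rademacher_norm n (W k)"
      using r B by (simp only: rademacher_norm_scale) simp
    moreover have "(\<Sum>j=1..n. \<bar>r / B * W k j\<bar>) = r / B * real n"
    proof -
      have "(\<Sum>j=1..n. \<bar>r / B * W k j\<bar>) = (\<Sum>j=1..n. r / B)"
        by (rule sum.cong) (use r B in \<open>simp_all add: abs_mult abs_sign_cube[OF Wk[OF k]]\<close>)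
      then show ?thesis by simp
    qed
    ultimately have "step_norm n K v (x k) =
        (1 - s) * (r / B * rademacher_mean n) + s * (r / B * real n)"
      unfolding N by (simp only: rademacher_norm_sign[OF Wk[OF k]])
    also have "\<dots> = r / B * ((1 - s) * rademacher_mean n + s * real n)"
      by (simp only: distrib_left mult.left_commute)
    also have "\<dots> = r / B * B"
      by (simp only: B_def)
    finally have "step_norm n K v (x k) = r / B * B" .
    then show "step_norm n K v (x k) \<le> r" using B by simp
  next
    fix j assume j: "j \<in> {1..n}"
    have xj: "x (2 ^ n + j - 1) = (\<lambda>i. if i = j then r else 0)"
      by (rule ext) (use j in \<open>auto simp: x_def mixed_step_def\<close>)
    have "pairing n (x (2 ^ n + j - 1)) \<epsilon> = r * \<epsilon> j" for \<epsilon>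
      unfolding xj using j by (simp add: pairing_def if_distrib[of "\<lambda>a. a * _"] cong: if_cong)
    then have "rademacher_norm n (x (2 ^ n + j - 1)) = (\<Sum>\<epsilon>\<in>sign_cube n. \<bar>r * \<epsilon> j\<bar>) / 2 ^ n"
      by (simp only: rademacher_norm_def)
    also have "(\<Sum>\<epsilon>\<in>sign_cube n. \<bar>r * \<epsilon> j\<bar>) = (\<Sum>\<epsilon>\<in>sign_cube n. r)"
      by (rule sum.cong) (use r in \<open>simp_all add: abs_mult abs_sign_cube[OF _ j]\<close>)
    finally have "rademacher_norm n (x (2 ^ n + j - 1)) = r" by (simp add: card_sign_cube)
    moreover have "(\<Sum>i=1..n. \<bar>x (2 ^ n + j - 1) i\<bar>) = r"
      unfolding xj using j r by (simp add: if_distrib[of abs] cong: if_cong)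
    ultimately show "step_norm n K v (x (2 ^ n + j - 1)) \<le> r"
      unfolding N by (simp only:) (simp add: algebra_simps)
  qed
  note pc = step_kernel_projection_constant[OF n(1) K r bio xr dual c_nonneg csum]
  have "\<not> projection_constant_attained (step_kernel n K v)"
  proof
    assume "projection_constant_attained (step_kernel n K v)"
    then obtain f :: "nat \<Rightarrow> C01" where f: "\<And>t. step_norm n K v (\<lambda>j. apply_bcontfun (f j) t) \<le> r"
      "\<And>k u. k < K \<Longrightarrow> u \<in> cell K k \<Longrightarrow> pairing n (\<lambda>j. apply_bcontfun (f j) (ui_of_real u)) (v k) = c k * r"
      using pc(3) by blast
    \<comment> \<open>The point \<open>1 / K\<close> belongs to cells 0 and 1, which carry different sign vectors because \<open>W\<close> is injective.\<close>
    define y where "y j = apply_bcontfun (f j) (ui_of_real (1 / real K))" for j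
    have forced: "y j = r / B * W k j" if k: "k < 2" and j: "j \<in> {1..n}" for k j
    proof -
      have "(2::nat) \<le> 2 ^ n" using n by (cases n) auto
      then have k2: "k < 2 ^ n" "k < K" using k by (auto simp: K_def)
      have "1 / real K \<in> cell K k"
        using k by (cases k) (auto simp: cell_def divide_right_mono)
      from f(2)[OF k2(2) this] have "(1 - s) / 2 ^ n * pairing n y (W k) = c k * r"
        using k2 by (simp add: y_def[symmetric] v_def pairing_mixed_step)
      also have "c k * r = (1 - s) / 2 ^ n * (real n * (r / B))"
        using k2 by (simp add: c_def)
      finally have "(1 - s) / 2 ^ n * pairing n y (W k) = (1 - s) / 2 ^ n * (real n * (r / B))" .
      moreover have "(1 - s) / 2 ^ n \<noteq> 0" using s by simp
      ultimately have p: "pairing n y (W k) = real n * (r / B)"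
        using mult_left_cancel by blast
      have "step_norm n K v y \<le> r" using f(1) by (simp add: y_def[abs_def])
      then have "(1 - s) * rademacher_norm n y + s * (\<Sum>j=1..n. \<bar>y j\<bar>) \<le> B / real n * pairing n y (W k)"
        unfolding N p using n B by simp
      also have "\<dots> = (1 - s) * (rademacher_mean n / real n * pairing n y (W k)) + s * pairing n y (W k)"
        using n by (simp add: B_def field_simps)
      \<comment> \<open>The \<open>\<ell>\<^sub>1\<close>-part of the mixture never beats its own bound \<open>l1\<close>, so the Rademacher
        part, which has positive weight \<open>1 - s\<close>, must be extremal by itself.\<close>
      also have "\<dots> \<le> (1 - s) * (rademacher_mean n / real n * pairing n y (W k)) + s * (\<Sum>j=1..n. \<bar>y j\<bar>)"
        using s l1[OF Wk[OF k2(1)]] by (intro add_left_mono mult_left_mono) auto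
      finally have "(1 - s) * rademacher_norm n y \<le> (1 - s) * (rademacher_mean n / real n * pairing n y (W k))"
        by linarith
      then have "rademacher_norm n y \<le> rademacher_mean n / real n * pairing n y (W k)"
        by (rule mult_left_le_imp_le) (use s in simp)
      then obtain d where d: "\<And>j. j \<in> {1..n} \<Longrightarrow> y j = d * W k j"
        using rademacher_norm_equality[OF n Wk[OF k2(1)]] by blast
      have "pairing n y (W k) = d * pairing n (W k) (W k)"
        unfolding pairing_def sum_distrib_left by (rule sum.cong) (use d in auto)
      then have "d = r / B"
        using p n B by (simp add: pairing_self[OF Wk[OF k2(1)]] field_simps)
      with d[OF j] show ?thesis by simp
    qed
    have "(2::nat) \<le> 2 ^ n" using n by (cases n) auto
    then have mem: "0 \<in> {..<2 ^ n :: nat}" "1 \<in> {..<2 ^ n :: nat}" by auto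
    have "W 0 = W 1"
    proof (rule sign_cube_eqI[OF Wk Wk])
      show "W 0 j = W 1 j" if "j \<in> {1..n}" for j
        using forced[of 0 j] forced[of 1 j] that r B by simp
    qed (use mem in auto)
    then have "(0::nat) = 1"
      using bij_betw_imp_inj_on[OF W] mem by (simp only: inj_on_eq_iff)
    then show False by simp
  qed
  with pc(1,2) subspace_step_kernel closed_step_kernel show ?thesis by blast
qed

text \<open>The reciprocal of the expression is continuous in \<open>s\<close>, with the value \<open>1 / \<beta>\<close> at \<open>s = 0\<close> and 1 at
  \<open>s = 1\<close>; the latter is excluded by \<open>1 < r\<close>.\<close>
lemma mixing_parameter_exists:
  assumes \<beta>: "0 < \<beta>" and n: "0 < (n::real)" and r: "1 < r" "r \<le> \<beta>"
  obtains s where "0 \<le> s" "s < 1" "r = 1 / ((1 - s) / ((1 - s) * \<beta> + s * n) + s)"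
proof -
  define g where "g s = (1 - s) / ((1 - s) * \<beta> + s * n) + s" for s
  have den: "(1 - s) * \<beta> + s * n \<noteq> 0" if "0 \<le> s" "s \<le> 1" for s
    using that \<beta> n by (cases "s = 0") (auto simp: add_nonneg_pos less_imp_neq[THEN not_sym])
  have "continuous_on {0..1} g"
    unfolding g_def by (intro continuous_intros) (use den in auto)
  moreover have "g 0 \<le> 1 / r" "1 / r \<le> g 1"
    using r \<beta> by (auto simp: g_def field_simps)
  ultimately obtain s where s: "0 \<le> s" "s \<le> 1" "g s = 1 / r"
    using IVT'[of g 0 "1 / r" 1] by auto
  have "s \<noteq> 1" using s(3) r by (auto simp: g_def)
  with s r show ?thesis
    by (intro that[of s]) (auto simp: g_def[symmetric])
qed

theorem theorem5p4:
  fixes n :: nat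
  assumes "n \<ge> 4" and "even n"
  shows "beta_const n =
      measure_pmf.expectation (sign_measure n) (\<lambda>\<omega>. \<bar>\<Sum>j=1..n. rademacher j \<omega>\<bar>) \<and>
    (\<forall>\<Lambda>::real. 2 < \<Lambda> \<and> \<Lambda> \<le> 1 + beta_const n \<longrightarrow>
      (\<exists>Y :: C01 set. subspace Y \<and> closed Y \<and> has_codimension Y n \<and>
        projection_constant Y = ereal \<Lambda> \<and> \<not> projection_constant_attained Y))"
proof (intro conjI allI impI)
  have n: "0 < n" using assms(1) by simp
  note \<beta> = beta_const_eq_rademacher_mean[OF assms(2) n]
  show "beta_const n =
      measure_pmf.expectation (sign_measure n) (\<lambda>\<omega>. \<bar>\<Sum>j=1..n. rademacher j \<omega>\<bar>)"
    unfolding \<beta> by (rule rademacher_mean_expectation)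
  fix \<Lambda> :: real
  assume \<Lambda>: "2 < \<Lambda> \<and> \<Lambda> \<le> 1 + beta_const n"
  then have pos: "0 < rademacher_mean n" by (simp add: \<beta>)
  obtain s where s: "0 \<le> s" "s < 1"
    "\<Lambda> - 1 = 1 / ((1 - s) / ((1 - s) * rademacher_mean n + s * real n) + s)"
    using mixing_parameter_exists[OF pos, of "real n" "\<Lambda> - 1"] \<Lambda> n \<beta> by auto
  show "\<exists>Y :: C01 set. subspace Y \<and> closed Y \<and> has_codimension Y n \<and>
        projection_constant Y = ereal \<Lambda> \<and> \<not> projection_constant_attained Y"
    using nonattained_step_kernel[OF n assms(2) pos s(1,2)] unfolding s(3)[symmetric] by simp
qed

end
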